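(* Let $R\ge 1$ be an integer, let $f:\mathbb{R}^m\to\mathbb{R}^m$ be sufficiently smooth, and consider the one-dimensional system of conservation laws $u_t+f(u)_x=0$. The approximate Lax-Wendroff-type scheme (defined in the context) $$u_i^{n+1}=u_i^n+\sum_{l=1}^{R}\frac{(\Delta t)^l}{l!}\,\widetilde u^{(l)}_{i,n},$$ is $R$-th order accurate. That is, for every sufficiently smooth exact solution $u(x,t)$ of $u_t+f(u)_x=0$, if the quantities $\widetilde u^{(l)}_{i,n}$ are computed from the exact data $\widetilde u^{(0)}_{j,n}=u(x_j,t_n)$ for all $j$, and $\Delta t=\tau h$ with $\tau>0$ fixed, then the local truncation error satisfies $$u(x_i,t_{n}+\Delta t)-\sum_{l=0}^{R}\frac{(\Delta t)^l}{l!}\,\widetilde u^{(l)}_{i,n}=\mathcal{O}(h^{R+1})\qquad (h\to 0),$$ uniformly for $(x_i,t_n)$ in compact sets.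
   Context: Grid: $x_i$, $i\in\mathbb{Z}$, is a uniform spatial grid with spacing $h=x_{i+1}-x_i>0$; $t_{n+1}=t_n+\Delta t$, and $\delta=\Delta t=\tau h$ with $\tau>0$ a fixed constant. Boundary effects are ignored (the solution is defined for all $x\in\mathbb{R}$). Grid functions: for a function $w:\mathbb{R}\to\mathbb{R}^m$, a base point $a$ and a spacing $h>0$, $G_{a,h}(w):\mathbb{Z}\to\mathbb{R}^m$ is $G_{a,h}(w)_i=w(a+ih)$. Centered difference operators: for integers $p,q\ge 1$ let $s=\lfloor\frac{p-1}{2}\rfloor+q$ and, for $v:\mathbb{Z}\to\mathbb{R}^m$, $$\Delta^{p,q}_h v=\frac{1}{h^p}\sum_{l=-s}^{s}\beta_l^{p,q}v_l,$$ where $(\beta_l^{p,q})_{l=-s}^{s}$ is the unique solution of the linear system $\sum_{l=-s}^{s}\beta_l^{p,q}l^{j}=0$ for $j=0,\dots,2s$, $j\ne p$, and $\sum_{l=-s}^{s}\beta_l^{p,q}l^{p}=p!$ (with $0^0=1$). It is the centered operator approximating $p$-th derivatives to order $2q$. WENO numerical fluxes: put $r=\lceil\frac{R+1}{2}\rceil$. The values $\hat f^n_{i+\frac12}=\hat f(u^n_{i-r+1},\dots,u^n_{i+r})$ are the numerical fluxes of the Shu-Osher finite difference scheme obtained from upwind WENO reconstructions of order $2r-1$ applied to split fluxes. Their order $2r-1$ means that, when evaluated on exact data $u^n_j=u(x_j,t_n)$ of a sufficiently smooth solution, $$\frac{\hat f^n_{i+\frac12}-\hat f^n_{i-\frac12}}{h}=[f(u)]_x(x_i,t_n)+\mathcal{O}(h^{2r-1}),$$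 uniformly for $(x_i,t_n)$ in compact sets. Scheme: given data $u_i^n$, $i\in\mathbb{Z}$, at time $t_n$, set $$\widetilde u^{(0)}_{i,n}=u_i^n,\qquad \widetilde u^{(1)}_{i,n}=-\frac{\hat f^n_{i+\frac12}-\hat f^n_{i-\frac12}}{h}.$$ For $k\ge 1$, once $\widetilde u^{(l)}_{i,n}$, $0\le l\le k$, are known, define the polynomial $T_k[h,i,n](\rho)=\sum_{l=0}^{k}\frac{\widetilde u^{(l)}_{i,n}}{l!}\rho^l$. Then recursively for $k=1,\dots,R-1$ define, for all $i$, $$\widetilde f^{(k)}_{i,n}=\Delta_\delta^{k,\lceil\frac{R-k}{2}\rceil}\Big(G_{0,\delta}\big(f(T_k[h,i,n])\big)\Big),\qquad \widetilde u^{(k+1)}_{i,n}=-\Delta_h^{1,\lceil\frac{R-k}{2}\rceil}\,\widetilde f^{(k)}_{i+\cdot,n},$$ where $f(T_k[h,i,n])$ is the function $\rho\mapsto f(T_k[h,i,n](\rho))$ and $\widetilde f^{(k)}_{i+\cdot,n}$ is the grid function $j\mapsto\widetilde f^{(k)}_{i+j,n}$. The new values are $u_i^{n+1}=u_i^n+\sum_{l=1}^{R}\frac{(\Delta t)^l}{l!}\widetilde u^{(l)}_{i,n}$. *)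

theory Defs
  imports "HOL-Analysis.Analysis"
begin

text \<open>
  \<open>Ck_on k S g\<close>: \<open>g\<close> is of class C^k on \<open>S\<close>. Derivatives are taken within \<open>S\<close>, so on a
  slab \<open>UNIV \<times> I\<close> they are one-sided in time at an endpoint that belongs to \<open>I\<close>.
  The notion is meant for open sets and for convex sets with nonempty interior, where the derivative
  within \<open>S\<close> is unique.
\<close>

primrec Ck_on :: "nat \<Rightarrow> 'a::euclidean_space set \<Rightarrow> ('a \<Rightarrow> 'b::real_normed_vector) \<Rightarrow> bool" where
  "Ck_on 0 S g \<longleftrightarrow> continuous_on S g"
| "Ck_on (Suc k) S g \<longleftrightarrow>
     g differentiable_on S \<and> (\<forall>v. Ck_on k S (\<lambda>x. frechet_derivative g (at x within S) v))"

text \<open>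
  Times at which a solution lives: an interval that may or may not contain an initial time, but
  has no last element, so that \<open>t + \<Delta>t\<close> stays in it for small \<open>\<Delta>t\<close>. (Smooth solutions of nonlinear
  conservation laws usually do not exist for all times.)
\<close>

definition time_interval :: "real set \<Rightarrow> bool" where
  "time_interval I \<longleftrightarrow> is_interval I \<and> (\<forall>t\<in>I. \<exists>s\<in>I. t < s)"

definition smooth_solution ::
    "nat \<Rightarrow> (real^'m \<Rightarrow> real^'m) \<Rightarrow> real set \<Rightarrow> (real \<Rightarrow> real \<Rightarrow> real^'m) \<Rightarrow> bool" where
  "smooth_solution N f I u \<longleftrightarrow>
     Ck_on N (UNIV \<times> I) (\<lambda>(x, t). u x t) \<and>
     (\<forall>x. \<forall>t\<in>I. \<exists>ut fx.
        ((\<lambda>s. u x s) has_vector_derivative ut) (at t within I) \<and>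
        ((\<lambda>y. f (u y t)) has_vector_derivative fx) (at x) \<and>
        ut + fx = 0)"

text \<open>
  \<open>E h a i t\<close> is a quantity at index \<open>i\<close> of the grid with base point \<open>a\<close> and spacing \<open>h\<close>, and at
  time \<open>t\<close>. It is O(h^p) as \<open>h\<close> tends to 0 from above, uniformly for grid points
  \<open>(a + i h, t)\<close> in compact sets.
\<close>

definition uniformly_bigo ::
    "real set \<Rightarrow> (real \<Rightarrow> real \<Rightarrow> int \<Rightarrow> real \<Rightarrow> 'b::real_normed_vector) \<Rightarrow> nat \<Rightarrow> bool" where
  "uniformly_bigo I E p \<longleftrightarrow>
     (\<forall>K. compact K \<and> K \<subseteq> UNIV \<times> I \<longrightarrow>
        (\<exists>C. \<forall>\<^sub>F h in at_right 0. \<forall>a i t.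
           (a + of_int i * h, t) \<in> K \<longrightarrow> norm (E h a i t) \<le> C * h ^ p))"

definition grid_fun :: "real \<Rightarrow> real \<Rightarrow> (real \<Rightarrow> 'b) \<Rightarrow> int \<Rightarrow> 'b" where
  "grid_fun a h w i = w (a + of_int i * h)"

definition fd_radius :: "nat \<Rightarrow> nat \<Rightarrow> int" where
  "fd_radius p q = int ((p - 1) div 2 + q)"

text \<open>The coefficients are extended by 0 outside the stencil, which makes them unique.\<close>

definition fd_coeff :: "nat \<Rightarrow> nat \<Rightarrow> int \<Rightarrow> real" where
  "fd_coeff p q = (THE \<beta>.
     (\<forall>l. l \<notin> {- fd_radius p q..fd_radius p q} \<longrightarrow> \<beta> l = 0) \<and>
     (\<forall>j::nat. int j \<le> 2 * fd_radius p q \<longrightarrow>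
        (\<Sum>l = - fd_radius p q..fd_radius p q. \<beta> l * of_int l ^ j) = (if j = p then fact p else 0)))"

definition central_diff :: "real \<Rightarrow> nat \<Rightarrow> nat \<Rightarrow> (int \<Rightarrow> 'b::real_vector) \<Rightarrow> 'b" where
  "central_diff h p q v =
     (1 / h ^ p) *\<^sub>R (\<Sum>l = - fd_radius p q..fd_radius p q. fd_coeff p q l *\<^sub>R v l)"

text \<open>
  A numerical flux is a function of the list of the \<open>2 * r\<close> stencil values
  \<open>v (i - r + 1), \<dots>, v (i + r)\<close>; \<open>num_flux r F v i\<close> is its value at the half point \<open>i + 1/2\<close>.
\<close>

definition num_flux :: "nat \<Rightarrow> ('b list \<Rightarrow> 'b) \<Rightarrow> (int \<Rightarrow> 'b) \<Rightarrow> int \<Rightarrow> 'b" where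
  "num_flux r F v i = F (map (\<lambda>j. v (i + j)) [1 - int r..int r])"

definition flux_diff ::
    "nat \<Rightarrow> ('b::real_vector list \<Rightarrow> 'b) \<Rightarrow> real \<Rightarrow> (int \<Rightarrow> 'b) \<Rightarrow> int \<Rightarrow> 'b" where
  "flux_diff r F h v i = (1 / h) *\<^sub>R (num_flux r F v i - num_flux r F v (i - 1))"

text \<open>
  The flux has order \<open>p\<close> on exact data of every solution of class C^M. For the reconstructions of
  order \<open>2 * r - 1\<close> used in the scheme, this is the only property of the flux that is specified.
\<close>

definition flux_has_order ::
    "nat \<Rightarrow> (real^'m \<Rightarrow> real^'m) \<Rightarrow> nat \<Rightarrow> ((real^'m) list \<Rightarrow> real^'m) \<Rightarrow> nat \<Rightarrow> bool" where
  "flux_has_order M f r F p \<longleftrightarrow>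
     (\<forall>I u. time_interval I \<and> smooth_solution M f I u \<longrightarrow>
        uniformly_bigo I
          (\<lambda>h a i t. flux_diff r F h (grid_fun a h (\<lambda>x. u x t)) i
             - vector_derivative (\<lambda>x. f (u x t)) (at (a + of_int i * h))) p)"

definition taylor_poly :: "nat \<Rightarrow> (nat \<Rightarrow> 'b::real_vector) \<Rightarrow> real \<Rightarrow> 'b" where
  "taylor_poly k c \<rho> = (\<Sum>l = 0..k. (\<rho> ^ l / fact l) *\<^sub>R c l)"

lemma taylor_poly_cong [fundef_cong]:
  assumes "k = k'" and "\<And>l. l \<le> k' \<Longrightarrow> c l = c' l"
  shows "taylor_poly k c = taylor_poly k' c'"
  using assms by (auto simp: taylor_poly_def fun_eq_iff intro!: sum.cong)

definition weno_radius :: "nat \<Rightarrow> nat" where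
  "weno_radius R = nat \<lceil>(real R + 1) / 2\<rceil>"

definition half_order :: "nat \<Rightarrow> nat \<Rightarrow> nat" where
  "half_order R k = nat \<lceil>(real R - real k) / 2\<rceil>"

text \<open>
  \<open>approx_deriv R f F h \<delta> v k i\<close> approximates the \<open>k\<close>-th time derivative of the solution at
  grid point \<open>i\<close>, for \<open>k \<le> R\<close>, from the data \<open>v\<close>; \<open>h\<close> and \<open>\<delta>\<close> are the spacings in space and time.
\<close>

fun approx_deriv ::
    "nat \<Rightarrow> ('b::real_vector \<Rightarrow> 'b) \<Rightarrow> ('b list \<Rightarrow> 'b) \<Rightarrow> real \<Rightarrow> real \<Rightarrow> (int \<Rightarrow> 'b) \<Rightarrow> nat \<Rightarrow> int \<Rightarrow> 'b"
  where
  "approx_deriv R f F h \<delta> v 0 i = v i"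
| "approx_deriv R f F h \<delta> v (Suc k) i =
     (if k = 0 then - flux_diff (weno_radius R) F h v i
      else - central_diff h 1 (half_order R k)
        (\<lambda>j. central_diff \<delta> k (half_order R k)
          (grid_fun 0 \<delta> (\<lambda>\<rho>. f (taylor_poly k (\<lambda>l. approx_deriv R f F h \<delta> v l (i + j)) \<rho>)))))"

end

theory Submission
  imports Defs
begin

text \<open>
  Write \<open>\<delta> = \<tau> h\<close>. If every \<open>u\<^sup>(\<^sup>l\<^sup>)\<close> with \<open>l \<ge> 1\<close> approximates \<open>\<partial>\<^sub>t\<^sup>l u\<close> up to \<open>O(h ^ (R + 1 - l))\<close>, then
  the weight \<open>\<delta> ^ l\<close> turns each of these errors into \<open>O(h ^ (R + 1))\<close>, and what is left is the
  remainder of the Taylor polynomial of \<open>u\<close> in time. So the theorem is an error bound for the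
  approximate time derivatives, proved by induction on \<open>l\<close>
  (\<open>approx_deriv_error\<close>, \<open>local_truncation_error\<close>).

  The case \<open>l = 1\<close> is the order of the numerical flux. In the step from \<open>k\<close> to \<open>k + 1\<close> the scheme
  is compared with itself, run on the exact derivatives \<open>U l = \<partial>\<^sub>t\<^sup>l u\<close>.

  Stability (\<open>time_diff_stable\<close>): at times \<open>\<rho> = O(\<delta>)\<close> the error of the coefficient \<open>l\<close> of the Taylor
  polynomial is multiplied by \<open>\<rho> ^ l\<close>, so the polynomial is wrong by \<open>O(h ^ (R + 1))\<close> only. As \<open>f\<close> is
  locally Lipschitz, dividing by \<open>\<delta> ^ k\<close> in the time difference and by \<open>h\<close> in the space difference
  leaves \<open>O(h ^ (R - k))\<close>.

  Consistency (\<open>model_step_consistent\<close>): let \<open>T\<^sub>k\<close> be the exact Taylor polynomial in time. The curves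
  \<open>f(T\<^sub>k)\<close> and \<open>f(u)\<close> agree up to \<open>O(\<rho> ^ (k + 1))\<close> and so have the same \<open>k\<close>-th derivative
  (\<open>flat_jet\<close>, \<open>taylor_model_derivative_at_0\<close>). Hence the time difference of \<open>f(T\<^sub>k)\<close> approximates
  \<open>\<partial>\<^sub>t\<^sup>k f(u)\<close> up to \<open>O(\<delta> ^ (2 q))\<close>, where \<open>2 q \<ge> R - k\<close>. This pointwise bound would be spoilt by the
  division by \<open>h\<close> in the space difference. But the error is a smooth function of \<open>x\<close>: the
  \<open>x\<close>-derivative commutes with the time difference, so it obeys the same bound
  (\<open>model_time_diff_consistent\<close>), and a difference quotient of the error is bounded by that derivative
  (\<open>central_diff_bound_derivative\<close>). Finally \<open>\<partial>\<^sub>x \<partial>\<^sub>t\<^sup>k f(u) = - U (k + 1)\<close> by the conservation law and the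
  symmetry of mixed derivatives (\<open>smooth_solution_jet\<close>).
\<close>

section \<open>Weights of the central differences\<close>

definition lagrange_basis :: "int set \<Rightarrow> int \<Rightarrow> real poly" where
  "lagrange_basis A l = (\<Prod>m\<in>A - {l}. smult (1 / (of_int l - of_int m)) [:- of_int m, 1:])"

lemma poly_lagrange_basis:
  assumes "finite A" "m \<in> A" "l \<in> A"
  shows "poly (lagrange_basis A l) (of_int m) = (if m = l then 1 else 0)"
proof (cases "m = l")
  case True
  then show ?thesis
    by (auto simp: lagrange_basis_def poly_prod intro!: prod.neutral simp flip: diff_divide_distrib)
next
  case False
  then show ?thesis
    using assms by (auto simp: lagrange_basis_def poly_prod intro!: prod_zero bexI[of _ m])
qed

lemma degree_lagrange_basis:
  assumes "finite A" "l \<in> A"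
  shows "degree (lagrange_basis A l) < card A"
proof -
  have "degree (lagrange_basis A l)
      \<le> sum (degree \<circ> (\<lambda>m. smult (1 / (of_int l - of_int m)) [:- of_int m, 1:] :: real poly)) (A - {l})"
    unfolding lagrange_basis_def by (rule degree_prod_sum_le) (use assms in auto)
  also have "\<dots> \<le> (\<Sum>m\<in>A - {l}. 1)"
    by (rule sum_mono) (auto)
  also have "\<dots> = card A - 1"
    using assms by (simp add: card_Diff_singleton)
  also have "\<dots> < card A"
    using assms by (metis card_gt_0_iff diff_less empty_iff zero_less_one)
  finally show ?thesis .
qed

lemma lagrange_interpolation:
  assumes "finite A" "degree P < card A"
  shows "P = (\<Sum>l\<in>A. smult (poly P (of_int l)) (lagrange_basis A l))"
proof (rule poly_eqI_degree[where A = "of_int ` A"])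
  fix x :: real assume "x \<in> of_int ` A"
  then obtain m where m: "m \<in> A" "x = of_int m" by auto
  have "poly (\<Sum>l\<in>A. smult (poly P (of_int l)) (lagrange_basis A l)) (of_int m)
      = (\<Sum>l\<in>A. poly P (of_int l) * (if m = l then 1 else 0))"
    unfolding poly_sum poly_smult
    by (rule sum.cong) (use assms m poly_lagrange_basis[OF assms(1)] in auto)
  also have "\<dots> = poly P (of_int m)"
    using assms m by (simp add: sum.delta' if_distrib cong: if_cong)
  finally show "poly P x = poly (\<Sum>l\<in>A. smult (poly P (of_int l)) (lagrange_basis A l)) x"
    using m by simp
next
  have card: "card (of_int ` A :: real set) = card A"
    by (simp add: card_image inj_on_def)
  then show "degree P < card (of_int ` A :: real set)" using assms by simp
  have "degree (\<Sum>l\<in>A. smult (poly P (of_int l)) (lagrange_basis A l)) < card A"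
    by (rule degree_sum_less)
      (use assms degree_lagrange_basis[OF assms(1)] in \<open>auto intro: le_less_trans[OF degree_smult_le]\<close>)
  then show "degree (\<Sum>l\<in>A. smult (poly P (of_int l)) (lagrange_basis A l)) < card (of_int ` A :: real set)"
    using card by simp
qed

text \<open>
  Existence and uniqueness of weights with prescribed moments is the invertibility of a Vandermonde
  matrix. Lagrange interpolation makes the inverse explicit: the coefficients of the basis
  polynomials solve the system, and testing against these polynomials recovers each weight from the
  moments.
\<close>

lemma moment_problem_ex1:
  fixes s :: nat and \<mu> :: "nat \<Rightarrow> real"
  defines "A \<equiv> {- int s..int s}"
  shows "\<exists>!\<beta>::int \<Rightarrow> real. (\<forall>l. l \<notin> A \<longrightarrow> \<beta> l = 0) \<and>
    (\<forall>j. int j \<le> 2 * int s \<longrightarrow> (\<Sum>l\<in>A. \<beta> l * of_int l ^ j) = \<mu> j)"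
proof (rule ex_ex1I)
  have fin: "finite A" and card: "card A = 2 * s + 1" by (auto simp: A_def)
  define \<beta> where "\<beta> l = (if l \<in> A then \<Sum>j\<le>2 * s. coeff (lagrange_basis A l) j * \<mu> j else 0)" for l
  have "(\<Sum>l\<in>A. \<beta> l * of_int l ^ j) = \<mu> j" if j: "int j \<le> 2 * int s" for j
  proof -
    have j': "j \<le> 2 * s" using j by linarith
    have "monom 1 j = (\<Sum>l\<in>A. smult (poly (monom 1 j) (of_int l)) (lagrange_basis A l))"
      by (rule lagrange_interpolation[OF fin]) (use j' in \<open>auto simp: card degree_monom_eq\<close>)
    then have c: "coeff (monom 1 j) i = (\<Sum>l\<in>A. of_int l ^ j * coeff (lagrange_basis A l) i)" for i
      by (metis (no_types, lifting) coeff_smult coeff_sum mult_1 poly_monom sum.cong)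
    have "(\<Sum>l\<in>A. \<beta> l * of_int l ^ j)
        = (\<Sum>l\<in>A. \<Sum>i\<le>2 * s. of_int l ^ j * coeff (lagrange_basis A l) i * \<mu> i)"
      by (rule sum.cong) (auto simp: \<beta>_def sum_distrib_left sum_distrib_right mult_ac)
    also have "\<dots> = (\<Sum>i\<le>2 * s. coeff (monom 1 j) i * \<mu> i)"
      by (subst sum.swap) (simp only: c sum_distrib_right)
    also have "\<dots> = (\<Sum>i\<le>2 * s. if i = j then \<mu> i else 0)"
      by (rule sum.cong) (auto simp: coeff_monom)
    also have "\<dots> = \<mu> j" using j' by simp
    finally show ?thesis .
  qed
  then show "\<exists>\<beta>. (\<forall>l. l \<notin> A \<longrightarrow> \<beta> l = 0) \<and>
    (\<forall>j. int j \<le> 2 * int s \<longrightarrow> (\<Sum>l\<in>A. \<beta> l * of_int l ^ j) = \<mu> j)"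
    by (intro exI[of _ \<beta>]) (auto simp: \<beta>_def)
next
  have fin: "finite A" and card: "card A = 2 * s + 1" by (auto simp: A_def)
  fix \<beta> \<gamma> :: "int \<Rightarrow> real"
  assume b: "(\<forall>l. l \<notin> A \<longrightarrow> \<beta> l = 0) \<and>
    (\<forall>j. int j \<le> 2 * int s \<longrightarrow> (\<Sum>l\<in>A. \<beta> l * of_int l ^ j) = \<mu> j)"
  assume g: "(\<forall>l. l \<notin> A \<longrightarrow> \<gamma> l = 0) \<and>
    (\<forall>j. int j \<le> 2 * int s \<longrightarrow> (\<Sum>l\<in>A. \<gamma> l * of_int l ^ j) = \<mu> j)"
  show "\<beta> = \<gamma>"
  proof
    fix m
    show "\<beta> m = \<gamma> m"
    proof (cases "m \<in> A")
      case True
      let ?P = "lagrange_basis A m"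
      have deg: "degree ?P \<le> 2 * s"
        using degree_lagrange_basis[OF fin True] card by simp
      have repr: "\<alpha> m = (\<Sum>i\<le>degree ?P. coeff ?P i * (\<Sum>l\<in>A. \<alpha> l * of_int l ^ i))" for \<alpha> :: "int \<Rightarrow> real"
      proof -
        have "\<alpha> m = (\<Sum>l\<in>A. \<alpha> l * poly ?P (of_int l))"
        proof -
          have "(\<Sum>l\<in>A. \<alpha> l * poly ?P (of_int l)) = (\<Sum>l\<in>A. if l = m then \<alpha> l else 0)"
            by (rule sum.cong) (use poly_lagrange_basis[OF fin _ True] in auto)
          then show ?thesis using fin True by simp
        qed
        also have "\<dots> = (\<Sum>l\<in>A. \<Sum>i\<le>degree ?P. coeff ?P i * (\<alpha> l * of_int l ^ i))"
          by (simp add: poly_altdef sum_distrib_left mult_ac)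
        also have "\<dots> = (\<Sum>i\<le>degree ?P. coeff ?P i * (\<Sum>l\<in>A. \<alpha> l * of_int l ^ i))"
          by (subst sum.swap) (simp add: sum_distrib_left)
        finally show ?thesis .
      qed
      have "\<beta> m = (\<Sum>i\<le>degree ?P. coeff ?P i * \<mu> i)"
        unfolding repr[of \<beta>] by (rule sum.cong) (use b deg in auto)
      moreover have "\<gamma> m = (\<Sum>i\<le>degree ?P. coeff ?P i * \<mu> i)"
        unfolding repr[of \<gamma>] by (rule sum.cong) (use g deg in auto)
      ultimately show ?thesis by simp
    next
      case False
      then show ?thesis using b g by simp
    qed
  qed
qed

text \<open>
  The predicate under the definite description in the definition of \<open>fd_coeff\<close>.
\<close>

definition is_fd_weights :: "nat \<Rightarrow> nat \<Rightarrow> (int \<Rightarrow> real) \<Rightarrow> bool" where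
  "is_fd_weights p q \<beta> \<longleftrightarrow>
     (\<forall>l. l \<notin> {- fd_radius p q..fd_radius p q} \<longrightarrow> \<beta> l = 0) \<and>
     (\<forall>j::nat. int j \<le> 2 * fd_radius p q \<longrightarrow>
        (\<Sum>l = - fd_radius p q..fd_radius p q. \<beta> l * of_int l ^ j) = (if j = p then fact p else 0))"

lemma fd_coeff_ex1: "\<exists>!\<beta>. is_fd_weights p q \<beta>"
  unfolding is_fd_weights_def
  using moment_problem_ex1[of "(p - 1) div 2 + q" "\<lambda>j. if j = p then fact p else 0"]
  by (simp add: fd_radius_def)

lemma fd_coeff_weights: "is_fd_weights p q (fd_coeff p q)"
proof -
  have "fd_coeff p q = (THE \<beta>. is_fd_weights p q \<beta>)"
    unfolding fd_coeff_def is_fd_weights_def ..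
  then show ?thesis using theI'[OF fd_coeff_ex1] by simp
qed

lemma sum_reflect:
  fixes h :: "int \<Rightarrow> 'a::comm_monoid_add"
  shows "(\<Sum>l = - s..s. h (- l)) = (\<Sum>l = - s..s. h l)"
  by (rule sum.reindex_bij_witness[where i = uminus and j = uminus]) auto

text \<open>
  The reflected weights, with the sign \<open>(-1) ^ p\<close>, solve the same linear system, so uniqueness
  identifies them with the original ones.
\<close>

lemma fd_coeff_reflect: "fd_coeff p q (- l) = (- 1) ^ p * fd_coeff p q l"
proof -
  let ?\<beta> = "fd_coeff p q" and ?s = "fd_radius p q"
  have w: "is_fd_weights p q ?\<beta>" by (rule fd_coeff_weights)
  have "is_fd_weights p q (\<lambda>l. (- 1) ^ p * ?\<beta> (- l))"
    unfolding is_fd_weights_def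
  proof (intro conjI allI impI)
    fix l assume "l \<notin> {- ?s..?s}"
    then show "(- 1) ^ p * ?\<beta> (- l) = 0" using w by (auto simp: is_fd_weights_def)
  next
    fix j assume j: "int j \<le> 2 * ?s"
    have "(\<Sum>l = - ?s..?s. (- 1) ^ p * ?\<beta> (- l) * of_int l ^ j)
        = (- 1) ^ p * (- 1) ^ j * (\<Sum>l = - ?s..?s. ?\<beta> (- l) * of_int (- l) ^ j)"
      unfolding sum_distrib_left
    proof (rule sum.cong)
      fix l
      have "(of_int l :: real) ^ j = (- 1) ^ j * of_int (- l) ^ j"
        by (simp flip: power_mult_distrib)
      then show "(- 1) ^ p * ?\<beta> (- l) * of_int l ^ j
          = (- 1) ^ p * (- 1) ^ j * (?\<beta> (- l) * of_int (- l) ^ j)"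
        by (simp only: mult_ac)
    qed simp
    also have "(\<Sum>l = - ?s..?s. ?\<beta> (- l) * of_int (- l) ^ j) = (\<Sum>l = - ?s..?s. ?\<beta> l * of_int l ^ j)"
      by (rule sum_reflect)
    also have "\<dots> = (if j = p then fact p else 0)"
      using w j unfolding is_fd_weights_def by blast
    finally show "(\<Sum>l = - ?s..?s. (- 1) ^ p * ?\<beta> (- l) * of_int l ^ j) = (if j = p then fact p else 0)"
      by (simp flip: power_add mult_2)
  qed
  with w fd_coeff_ex1 have "(\<lambda>l. (- 1) ^ p * ?\<beta> (- l)) = ?\<beta>" by blast
  then have "?\<beta> l = (- 1) ^ p * ?\<beta> (- l)" by metis
  then show ?thesis by (simp flip: power_add mult_2 mult.assoc)
qed

text \<open>
  For odd \<open>p\<close> the defining system already prescribes all moments below \<open>p + 2 q\<close>. For even \<open>p\<close> it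
  stops one short, and the missing odd moment vanishes by symmetry. This is what makes the centered
  operators accurate to the even order \<open>2 q\<close>.
\<close>

lemma fd_coeff_moment:
  assumes "1 \<le> p" "1 \<le> q" "j < p + 2 * q"
  shows "(\<Sum>l = - fd_radius p q..fd_radius p q. fd_coeff p q l * of_int l ^ j)
    = (if j = p then fact p else 0)"
proof (cases "int j \<le> 2 * fd_radius p q")
  case True
  then show ?thesis using fd_coeff_weights[of p q] unfolding is_fd_weights_def by blast
next
  case False
  let ?S = "\<Sum>l = - fd_radius p q..fd_radius p q. fd_coeff p q l * of_int l ^ j"
  have parity: "odd (p + j)" "j \<noteq> p"
    using False assms unfolding fd_radius_def by presburger+
  have "?S = (\<Sum>l = - fd_radius p q..fd_radius p q. fd_coeff p q (- l) * of_int (- l) ^ j)"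
    by (rule sum_reflect[symmetric])
  also have "\<dots> = (- 1) ^ (p + j) * ?S"
    unfolding sum_distrib_left fd_coeff_reflect
    by (rule sum.cong) (auto simp: power_add power_minus[of "of_int _"] mult_ac)
  finally show ?thesis using parity by simp
qed

section \<open>Taylor expansion and consistency of the central differences\<close>

lemma vector_mean_value_bound:
  fixes f :: "real \<Rightarrow> 'b::real_normed_vector"
  assumes "convex J" "\<And>r. r \<in> J \<Longrightarrow> (f has_vector_derivative f' r) (at r within J)"
    and "\<And>r. r \<in> J \<Longrightarrow> norm (f' r) \<le> B" "s \<in> J" "t \<in> J"
  shows "norm (f s - f t) \<le> B * \<bar>s - t\<bar>"
proof -
  have "norm (f s - f t) \<le> B * norm (s - t)"
  proof (rule differentiable_bound[OF assms(1) _ _ assms(4,5)])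
    show "(f has_derivative (\<lambda>h. h *\<^sub>R f' r)) (at r within J)" if "r \<in> J" for r
      using assms(2)[OF that] by (simp add: has_vector_derivative_def)
    show "onorm (\<lambda>h. h *\<^sub>R f' r) \<le> B" if "r \<in> J" for r
      by (rule onorm_le) (use assms(3)[OF that] in \<open>simp add: mult.commute[of B] mult_left_mono\<close>)
  qed
  then show ?thesis by simp
qed

text \<open>
  A local Lipschitz constant at a point bounds the derivative there.
\<close>

lemma norm_vector_derivative_le:
  fixes f :: "real \<Rightarrow> 'b::real_normed_vector"
  assumes "(f has_vector_derivative f') (at x)" "0 < d"
    and "\<And>y. \<bar>y - x\<bar> < d \<Longrightarrow> norm (f y - f x) \<le> K * \<bar>y - x\<bar>"
  shows "norm f' \<le> K"
proof (rule field_le_epsilon)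
  fix e :: real assume "0 < e"
  with assms(1) obtain c where c: "0 < c"
    "\<And>y. norm (y - x) < c \<Longrightarrow> norm (f y - f x - (y - x) *\<^sub>R f') \<le> e * norm (y - x)"
    unfolding has_vector_derivative_def has_derivative_at_alt by blast
  define y where "y = x + min c d / 2"
  have y: "y - x > 0" "y - x < c" "y - x < d"
    using c(1) assms(2) by (auto simp: y_def min_def)
  have "norm ((y - x) *\<^sub>R f') \<le> norm (f y - f x) + norm (f y - f x - (y - x) *\<^sub>R f')"
    using norm_triangle_ineq4[of "f y - f x" "f y - f x - (y - x) *\<^sub>R f'"] by simp
  also have "\<dots> \<le> K * \<bar>y - x\<bar> + e * norm (y - x)"
    using y by (intro add_mono assms(3) c(2)) auto
  also have "\<dots> = (y - x) * (K + e)"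
    using y(1) by (simp add: algebra_simps)
  finally have "(y - x) * norm f' \<le> (y - x) * (K + e)"
    using y(1) by simp
  then show "norm f' \<le> K + e"
    using y(1) by (simp only: mult_le_cancel_left_pos)
qed

text \<open>
  The family \<open>W\<close> lists a function and its derivatives within \<open>J\<close>, so that one statement serves
  both for full lines and for time intervals with an endpoint. The bound is cruder than the usual one
  by the factor \<open>fact n\<close>, which keeps the induction a single use of the mean value inequality: the
  derivative of the remainder is the remainder of the derivative.
\<close>

lemma taylor_bound:
  fixes W :: "nat \<Rightarrow> real \<Rightarrow> 'b::real_normed_vector"
  assumes "convex J" "t \<in> J" "s \<in> J"
    and "\<And>j r. j < n \<Longrightarrow> r \<in> J \<Longrightarrow> (W j has_vector_derivative W (Suc j) r) (at r within J)"
    and "\<And>r. r \<in> closed_segment t s \<Longrightarrow> norm (W n r) \<le> B"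
  shows "norm (W 0 s - (\<Sum>j<n. ((s - t) ^ j / fact j) *\<^sub>R W j t)) \<le> B * \<bar>s - t\<bar> ^ n"
  using assms(3-)
proof (induction n arbitrary: W s)
  case 0
  then show ?case by simp
next
  case (Suc n)
  define E where "E r = W 0 r - (\<Sum>j<Suc n. ((r - t) ^ j / fact j) *\<^sub>R W j t)" for r
  define E' where "E' r = W 1 r - (\<Sum>j<n. ((r - t) ^ j / fact j) *\<^sub>R W (Suc j) t)" for r
  have seg: "closed_segment t s \<subseteq> J"
    using assms(1,2) Suc.prems(1) by (simp add: closed_segment_subset)
  have B: "0 \<le> B"
    by (meson Suc.prems(3) ends_in_segment(1) norm_ge_zero order_trans)
  have "norm (E s - E t) \<le> (B * \<bar>s - t\<bar> ^ n) * \<bar>s - t\<bar>"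
  proof (rule vector_mean_value_bound[where J = "closed_segment t s" and f' = E'])
    fix r assume r: "r \<in> closed_segment t s"
    have W: "(W 0 has_vector_derivative W 1 r) (at r within closed_segment t s)"
      using has_vector_derivative_within_subset[OF _ seg] Suc.prems(2)[of 0 r] seg r by auto
    have "((\<lambda>r. \<Sum>j<Suc n. ((r - t) ^ j / fact j) *\<^sub>R W j t) has_vector_derivative
        (\<Sum>j<n. ((r - t) ^ j / fact j) *\<^sub>R W (Suc j) t)) (at r within closed_segment t s)"
    proof -
      have "((\<lambda>r. ((r - t) ^ Suc j / fact (Suc j)) *\<^sub>R W (Suc j) t) has_vector_derivative
          ((r - t) ^ j / fact j) *\<^sub>R W (Suc j) t) (at r within closed_segment t s)" for j
      proof -
        have "((\<lambda>r. (r - t) ^ Suc j / fact (Suc j)) has_real_derivative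
            real (Suc j) * (r - t) ^ j / fact (Suc j)) (at r within closed_segment t s)"
          by (intro DERIV_cdivide) (auto intro!: derivative_eq_intros simp del: power_Suc)
        also have "real (Suc j) * (r - t) ^ j / fact (Suc j) = (r - t) ^ j / fact j"
          by (simp del: of_nat_Suc)
        finally have "((\<lambda>r. (r - t) ^ Suc j / fact (Suc j)) has_real_derivative (r - t) ^ j / fact j)
            (at r within closed_segment t s)" .
        from has_vector_derivative_scaleR[OF this has_vector_derivative_const] show ?thesis by simp
      qed
      then have "((\<lambda>r. \<Sum>j<n. ((r - t) ^ Suc j / fact (Suc j)) *\<^sub>R W (Suc j) t)
          has_vector_derivative (\<Sum>j<n. ((r - t) ^ j / fact j) *\<^sub>R W (Suc j) t))
          (at r within closed_segment t s)"
        by (intro has_vector_derivative_sum)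
      from has_vector_derivative_add[OF has_vector_derivative_const[of "W 0 t"] this]
      show ?thesis
        unfolding sum.lessThan_Suc_shift by simp
    qed
    with W show "(E has_vector_derivative E' r) (at r within closed_segment t s)"
      unfolding E_def E'_def by (rule has_vector_derivative_diff)
    have sub: "closed_segment t r \<subseteq> closed_segment t s"
      using r by (simp add: subset_closed_segment)
    have "norm (E' r) \<le> B * \<bar>r - t\<bar> ^ n"
      unfolding E'_def using Suc.IH[of r "\<lambda>j. W (Suc j)"] Suc.prems(2) subsetD[OF seg r]
        Suc.prems(3)[OF subsetD[OF sub]] by auto
    also have "\<dots> \<le> B * \<bar>s - t\<bar> ^ n"
      using r B by (intro mult_left_mono power_mono)
        (auto simp: closed_segment_eq_real_ivl split: if_splits)
    finally show "norm (E' r) \<le> B * \<bar>s - t\<bar> ^ n" .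
  qed auto
  moreover have "E t = 0"
    unfolding E_def sum.lessThan_Suc_shift by simp
  ultimately show ?case unfolding E_def by (simp add: mult_ac)
qed

lemma continuous_on_compact_bounded:
  assumes "continuous_on S g" "compact K" "K \<subseteq> S"
  obtains B where "\<And>p. p \<in> K \<Longrightarrow> norm (g p) \<le> B"
proof -
  have "bounded (g ` K)"
    using assms by (intro compact_imp_bounded compact_continuous_image continuous_on_subset[OF assms(1)])
  then obtain B where "\<forall>w\<in>g ` K. norm w \<le> B"
    unfolding bounded_iff by blast
  then show thesis by (intro that) auto
qed

text \<open>
  A function that is \<open>O(s ^ (k + 1))\<close> to the right of 0 has vanishing derivatives up to order \<open>k\<close>: if
  the lower ones vanish, Taylor's formula says that \<open>s ^ j / fact j\<close> times the \<open>j\<close>-th derivative is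
  \<open>O(s ^ (j + 1))\<close>. A one-sided neighbourhood is enough, and it is all that an initial time offers.
\<close>

lemma flat_jet:
  fixes W :: "nat \<Rightarrow> real \<Rightarrow> 'b::real_normed_vector"
  assumes "0 < \<epsilon>"
    and W: "\<And>j s. j \<le> k \<Longrightarrow> 0 \<le> s \<Longrightarrow> s \<le> \<epsilon> \<Longrightarrow>
      (W j has_vector_derivative W (Suc j) s) (at s within {0..\<epsilon>})"
    and cont: "continuous_on {0..\<epsilon>} (W (Suc k))"
    and small: "\<And>s. 0 \<le> s \<Longrightarrow> s \<le> \<epsilon> \<Longrightarrow> norm (W 0 s) \<le> C * s ^ Suc k"
    and "j \<le> k"
  shows "W j 0 = 0"
  using \<open>j \<le> k\<close>
proof (induction j rule: less_induct)
  case (less j)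
  have "continuous_on {0..\<epsilon>} (W (Suc j))"
  proof (cases "j = k")
    case False
    then show ?thesis
      using less.prems W[of "Suc j"] by (auto intro!: continuous_on_vector_derivative)
  qed (use cont in simp)
  then have "bounded (W (Suc j) ` {0..\<epsilon>})"
    by (intro compact_imp_bounded compact_continuous_image) auto
  then obtain B where "\<forall>w\<in>W (Suc j) ` {0..\<epsilon>}. norm w \<le> B"
    unfolding bounded_iff by blast
  then have B: "norm (W (Suc j) s) \<le> B" if "0 \<le> s" "s \<le> \<epsilon>" for s
    using that by simp
  have C: "0 \<le> C"
  proof -
    have "0 \<le> C * \<epsilon> ^ Suc k"
      using small[of \<epsilon>] \<open>0 < \<epsilon>\<close> by (intro order_trans[OF norm_ge_zero]) auto
    then show ?thesis
      using zero_less_power[OF \<open>0 < \<epsilon>\<close>, of "Suc k"] by (simp add: zero_le_mult_iff)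
  qed
  define K where "K = fact j * (B + C * \<epsilon> ^ (k - j))"
  \<comment> \<open>The given bound on \<open>W 0\<close> is at least as small as \<open>s ^ (j + 1)\<close>, up to the factor \<open>\<epsilon> ^ (k - j)\<close> in \<open>K\<close>.\<close>
  have bound: "norm (W j 0) \<le> K * s" if s: "0 < s" "s \<le> \<epsilon>" for s
  proof -
    have "norm (W 0 s - (\<Sum>i<Suc j. ((s - 0) ^ i / fact i) *\<^sub>R W i 0)) \<le> B * \<bar>s - 0\<bar> ^ Suc j"
    proof (rule taylor_bound[where J = "{0..\<epsilon>}"])
      show "norm (W (Suc j) r) \<le> B" if "r \<in> closed_segment 0 s" for r
        using that s by (intro B) (auto simp: closed_segment_eq_real_ivl split: if_splits)
    qed (use s less.prems W \<open>0 < \<epsilon>\<close> in auto)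
    moreover have "(\<Sum>i<Suc j. ((s - 0) ^ i / fact i) *\<^sub>R W i 0) = (s ^ j / fact j) *\<^sub>R W j 0"
      using less by (simp add: sum.neutral)
    ultimately have "norm (W 0 s - (s ^ j / fact j) *\<^sub>R W j 0) \<le> B * s ^ Suc j"
      using s by simp
    then have "norm ((s ^ j / fact j) *\<^sub>R W j 0) \<le> norm (W 0 s) + B * s ^ Suc j"
      using norm_triangle_ineq4[of "W 0 s" "W 0 s - (s ^ j / fact j) *\<^sub>R W j 0"] by simp
    also have "norm (W 0 s) \<le> C * s ^ Suc k"
      using small s by simp
    also have "C * s ^ Suc k = C * s ^ Suc j * s ^ (k - j)"
      using less.prems by (simp flip: power_add)
    also have "\<dots> \<le> C * s ^ Suc j * \<epsilon> ^ (k - j)"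
      using s C by (intro mult_left_mono power_mono) auto
    finally have "s ^ j * norm (W j 0) \<le> s ^ j * (K * s)"
      using s by (simp add: K_def field_simps)
    then show ?thesis using s by simp
  qed
  have "((\<lambda>s. K * s) \<longlongrightarrow> K * 0) (at_right 0)"
    by (intro tendsto_intros)
  then have "norm (W j 0) \<le> K * 0"
    by (rule tendsto_lowerbound)
      (auto simp: eventually_at_right_field intro!: exI[of _ \<epsilon>] bound \<open>0 < \<epsilon>\<close>)
  then show ?case by simp
qed

lemma central_diff_diff:
  "central_diff h p q (\<lambda>j. v j - w j) = central_diff h p q v - central_diff h p q w"
  by (simp add: central_diff_def scaleR_diff_right sum_subtractf)

text \<open>
  The absolute moments of the weights: the constants in all estimates for \<open>central_diff\<close>.
\<close>

definition fd_weight_norm :: "nat \<Rightarrow> nat \<Rightarrow> nat \<Rightarrow> real" where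
  "fd_weight_norm p q n = (\<Sum>l = - fd_radius p q..fd_radius p q. \<bar>fd_coeff p q l\<bar> * \<bar>of_int l\<bar> ^ n)"

lemma fd_weight_norm_nonneg: "0 \<le> fd_weight_norm p q n"
  unfolding fd_weight_norm_def by (intro sum_nonneg) auto

lemma central_diff_bound:
  fixes v :: "int \<Rightarrow> 'b::real_normed_vector"
  assumes "0 < h" and "\<And>l. \<bar>l\<bar> \<le> fd_radius p q \<Longrightarrow> norm (v l) \<le> B * \<bar>of_int l\<bar> ^ n"
  shows "norm (central_diff h p q v) \<le> fd_weight_norm p q n * B / h ^ p"
proof -
  have "norm (\<Sum>l = - fd_radius p q..fd_radius p q. fd_coeff p q l *\<^sub>R v l)
      \<le> (\<Sum>l = - fd_radius p q..fd_radius p q. \<bar>fd_coeff p q l\<bar> * (B * \<bar>of_int l\<bar> ^ n))"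
    by (rule sum_norm_le) (auto intro!: mult_left_mono assms(2))
  also have "\<dots> = fd_weight_norm p q n * B"
    by (simp add: fd_weight_norm_def sum_distrib_left mult_ac)
  finally show ?thesis
    using assms(1) by (simp add: central_diff_def divide_right_mono)
qed

text \<open>
  The weights sum to 0, so the operator only sees increments of \<open>w\<close>, which are \<open>O(h)\<close> and compensate
  the division by \<open>h\<close>. An error with a small derivative is therefore differenced without loss of
  order.
\<close>

lemma central_diff_bound_derivative:
  fixes w :: "real \<Rightarrow> 'b::real_normed_vector"
  assumes "1 \<le> q" "0 < h" "of_int (fd_radius 1 q) * h \<le> r"
    and "\<And>s. \<bar>s\<bar> \<le> r \<Longrightarrow> (w has_vector_derivative w' s) (at s)"
    and "\<And>s. \<bar>s\<bar> \<le> r \<Longrightarrow> norm (w' s) \<le> B"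
  shows "norm (central_diff h 1 q (grid_fun 0 h w)) \<le> fd_weight_norm 1 q 1 * B"
proof -
  have "(\<Sum>l = - fd_radius 1 q..fd_radius 1 q. fd_coeff 1 q l) = 0"
    using fd_coeff_moment[of 1 q 0] assms(1) by simp
  then have "central_diff h 1 q (\<lambda>j. w 0) = 0"
    by (simp add: central_diff_def flip: scaleR_left.sum)
  then have "central_diff h 1 q (grid_fun 0 h w) = central_diff h 1 q (\<lambda>j. grid_fun 0 h w j - w 0)"
    by (simp add: central_diff_diff)
  also have "norm \<dots> \<le> fd_weight_norm 1 q 1 * (B * h) / h ^ 1"
  proof (rule central_diff_bound[OF assms(2)])
    fix l assume l: "\<bar>l\<bar> \<le> fd_radius 1 q"
    have "\<bar>of_int l * h\<bar> \<le> of_int (fd_radius 1 q) * h"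
      using l assms(2) by (simp add: abs_mult flip: of_int_abs)
    with assms(3) have lr: "\<bar>of_int l * h\<bar> \<le> r"
      by linarith
    have "norm (w (of_int l * h) - w 0) \<le> B * \<bar>of_int l * h - 0\<bar>"
    proof (rule vector_mean_value_bound[where J = "{-r..r}" and f' = w'])
      show "(w has_vector_derivative w' s) (at s within {-r..r})" if "s \<in> {-r..r}" for s
        using assms(4)[of s] that by (auto intro: has_vector_derivative_at_within)
    qed (use assms(5) lr in auto)
    then show "norm (grid_fun 0 h w l - w 0) \<le> B * h * \<bar>of_int l\<bar> ^ 1"
      using assms(2) by (simp add: grid_fun_def abs_mult mult_ac)
  qed
  finally show ?thesis using assms(2) by simp
qed

text \<open>
  The Taylor polynomial of degree \<open>p + 2 q - 1\<close> is differentiated exactly because of the moments, and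
  the remainder is \<open>O(h ^ (p + 2 q))\<close> on the stencil.
\<close>

lemma central_diff_consistent:
  fixes W :: "nat \<Rightarrow> real \<Rightarrow> 'b::real_normed_vector"
  assumes pq: "1 \<le> p" "1 \<le> q" and h: "0 < h" "of_int (fd_radius p q) * h \<le> r"
    and W: "\<And>j s. j < p + 2 * q \<Longrightarrow> \<bar>s\<bar> \<le> r \<Longrightarrow> (W j has_vector_derivative W (Suc j) s) (at s)"
    and B: "\<And>s. \<bar>s\<bar> \<le> r \<Longrightarrow> norm (W (p + 2 * q) s) \<le> B"
  shows "norm (central_diff h p q (grid_fun 0 h (W 0)) - W p 0)
    \<le> fd_weight_norm p q (p + 2 * q) * B * h ^ (2 * q)"
proof -
  let ?n = "p + 2 * q"
  define P where "P l = (\<Sum>j<?n. ((of_int l * h) ^ j / fact j) *\<^sub>R W j 0)" for l :: int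
  have "central_diff h p q P = (1 / h ^ p) *\<^sub>R (\<Sum>j<?n. (h ^ j / fact j *
      (\<Sum>l = - fd_radius p q..fd_radius p q. fd_coeff p q l * of_int l ^ j)) *\<^sub>R W j 0)"
    unfolding central_diff_def P_def scaleR_sum_right scaleR_left.sum sum_distrib_left
    by (subst sum.swap) (simp add: power_mult_distrib mult_ac)
  also have "\<dots> = (1 / h ^ p) *\<^sub>R (\<Sum>j<?n. (if j = p then h ^ p *\<^sub>R W p 0 else 0))"
    by (intro arg_cong2[where f = scaleR] sum.cong) (use pq in \<open>auto simp: fd_coeff_moment\<close>)
  also have "\<dots> = W p 0" using h pq by simp
  finally have "central_diff h p q (grid_fun 0 h (W 0)) - W p 0
      = central_diff h p q (\<lambda>l. grid_fun 0 h (W 0) l - P l)"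
    by (simp add: central_diff_diff)
  also have "norm \<dots> \<le> fd_weight_norm p q ?n * (B * h ^ ?n) / h ^ p"
  proof (rule central_diff_bound[OF h(1)])
    fix l assume l: "\<bar>l\<bar> \<le> fd_radius p q"
    have "\<bar>of_int l * h\<bar> \<le> of_int (fd_radius p q) * h"
      using l h(1) by (simp add: abs_mult flip: of_int_abs)
    with h(2) have lr: "\<bar>of_int l * h\<bar> \<le> r"
      by linarith
    have "norm (W 0 (of_int l * h) - (\<Sum>j<?n. ((of_int l * h - 0) ^ j / fact j) *\<^sub>R W j 0))
        \<le> B * \<bar>of_int l * h - 0\<bar> ^ ?n"
    proof (rule taylor_bound[where J = "{-r..r}"])
      show "(W j has_vector_derivative W (Suc j) s) (at s within {-r..r})"
        if "j < ?n" "s \<in> {-r..r}" for j s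
        using W[of j s] that by (auto intro: has_vector_derivative_at_within)
      show "norm (W ?n s) \<le> B" if "s \<in> closed_segment 0 (of_int l * h)" for s
        using that lr by (intro B) (auto simp: closed_segment_eq_real_ivl split: if_splits)
    qed (use lr in auto)
    then show "norm (grid_fun 0 h (W 0) l - P l) \<le> B * h ^ ?n * \<bar>of_int l\<bar> ^ ?n"
      using h(1) by (simp add: grid_fun_def P_def abs_mult power_mult_distrib mult_ac)
  qed
  also have "\<dots> = fd_weight_norm p q ?n * B * h ^ (2 * q)"
    using h(1) by (simp add: power_add)
  finally show ?thesis .
qed

section \<open>Functions of class C^k on a set\<close>

text \<open>
  The same notion as \<open>Ck_on\<close>, with the derivative existentially quantified. The derivative of a sum,
  product or composition may then be given by its formula, without a proof that derivatives within
  \<open>S\<close> are unique.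
\<close>

primrec is_Ck :: "nat \<Rightarrow> 'a::euclidean_space set \<Rightarrow> ('a \<Rightarrow> 'b::real_normed_vector) \<Rightarrow> bool" where
  "is_Ck 0 S g \<longleftrightarrow> continuous_on S g"
| "is_Ck (Suc k) S g \<longleftrightarrow>
     (\<exists>g'. (\<forall>x\<in>S. (g has_derivative g' x) (at x within S)) \<and> (\<forall>v. is_Ck k S (\<lambda>x. g' x v)))"

lemma is_CkI:
  assumes "\<And>x. x \<in> S \<Longrightarrow> (g has_derivative g' x) (at x within S)" "\<And>v. is_Ck k S (\<lambda>x. g' x v)"
  shows "is_Ck (Suc k) S g"
  using assms by auto

lemma is_CkE:
  assumes "is_Ck (Suc k) S g"
  obtains g' where "\<And>x. x \<in> S \<Longrightarrow> (g has_derivative g' x) (at x within S)"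
    "\<And>v. is_Ck k S (\<lambda>x. g' x v)"
  using assms by auto

declare is_Ck.simps(2) [simp del]

lemma Ck_on_mono: "Ck_on n S g \<Longrightarrow> k \<le> n \<Longrightarrow> Ck_on k S g"
proof (induction n arbitrary: g k)
  case (Suc n)
  show ?case
  proof (cases k)
    case 0
    then show ?thesis using Suc.prems by (auto intro: differentiable_imp_continuous_on)
  next
    case (Suc j)
    then show ?thesis using Suc.prems Suc.IH by auto
  qed
qed simp

lemma is_Ck_if_Ck_on: "Ck_on k S g \<Longrightarrow> is_Ck k S g"
proof (induction k arbitrary: g)
  case (Suc k)
  then show ?case
    by (intro is_CkI[where g' = "\<lambda>x. frechet_derivative g (at x within S)"])
      (auto simp: differentiable_on_def frechet_derivative_works)
qed simp

lemma is_Ck_SucD: "is_Ck (Suc k) S g \<Longrightarrow> is_Ck k S g"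
proof (induction k arbitrary: g)
  case 0
  then obtain g' where "\<And>x. x \<in> S \<Longrightarrow> (g has_derivative g' x) (at x within S)"
    by (auto simp: is_Ck.simps(2))
  then show ?case
    unfolding is_Ck.simps by (rule has_derivative_continuous_on)
next
  case (Suc k)
  from Suc.prems obtain g' where
    "\<And>x. x \<in> S \<Longrightarrow> (g has_derivative g' x) (at x within S)" "\<And>v. is_Ck (Suc k) S (\<lambda>x. g' x v)"
    by (auto simp: is_Ck.simps(2))
  then show ?case using Suc.IH by (intro is_CkI[where g' = g']) auto
qed

lemma is_Ck_mono: "is_Ck n S g \<Longrightarrow> k \<le> n \<Longrightarrow> is_Ck k S g"
  by (induction n) (auto simp: le_Suc_eq dest: is_Ck_SucD)

lemma is_Ck_continuous: "is_Ck k S g \<Longrightarrow> continuous_on S g"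
  using is_Ck_mono[of k S g 0] by simp

lemma is_Ck_cong:
  assumes "is_Ck k S g" "\<And>x. x \<in> S \<Longrightarrow> h x = g x"
  shows "is_Ck k S h"
proof (cases k)
  case 0
  then show ?thesis using assms by (simp cong: continuous_on_cong)
next
  case (Suc j)
  with assms(1) obtain g' where g':
    "\<And>x. x \<in> S \<Longrightarrow> (g has_derivative g' x) (at x within S)" "\<And>v. is_Ck j S (\<lambda>x. g' x v)"
    by (metis is_CkE)
  show ?thesis
    unfolding Suc by (rule is_CkI[OF has_derivative_transform[OF _ assms(2) g'(1)] g'(2)])
qed

lemma is_Ck_const: "is_Ck k S (\<lambda>x. c)"
proof (induction k arbitrary: c)
  case (Suc k)
  then show ?case by (intro is_CkI[where g' = "\<lambda>x v. 0"]) auto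
qed simp

lemma is_Ck_bounded_linear:
  assumes "bounded_linear L" "is_Ck k S g"
  shows "is_Ck k S (\<lambda>x. L (g x))"
  using assms(2)
proof (induction k arbitrary: g)
  case 0
  then show ?case using bounded_linear.continuous_on[OF assms(1)] by simp
next
  case (Suc k)
  from Suc.prems obtain g' where
    "\<And>x. x \<in> S \<Longrightarrow> (g has_derivative g' x) (at x within S)" "\<And>v. is_Ck k S (\<lambda>x. g' x v)"
    by (auto simp: is_Ck.simps(2))
  then show ?case
    by (intro is_CkI[where g' = "\<lambda>x v. L (g' x v)"] Suc.IH bounded_linear.has_derivative[OF assms(1)])
qed

lemma is_Ck_linear: "bounded_linear L \<Longrightarrow> is_Ck k S L"
  by (cases k) (auto intro!: is_CkI is_Ck_const bounded_linear_imp_has_derivative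
      linear_continuous_on)

lemma is_Ck_add:
  assumes "is_Ck k S g" "is_Ck k S h"
  shows "is_Ck k S (\<lambda>x. g x + h x)"
  using assms
proof (induction k arbitrary: g h)
  case 0
  then show ?case by (auto intro: continuous_on_add)
next
  case (Suc k)
  from Suc.prems(1) obtain g' where
    "\<And>x. x \<in> S \<Longrightarrow> (g has_derivative g' x) (at x within S)" "\<And>v. is_Ck k S (\<lambda>x. g' x v)"
    by (auto simp: is_Ck.simps(2))
  moreover from Suc.prems(2) obtain h' where
    "\<And>x. x \<in> S \<Longrightarrow> (h has_derivative h' x) (at x within S)" "\<And>v. is_Ck k S (\<lambda>x. h' x v)"
    by (auto simp: is_Ck.simps(2))
  ultimately show ?case
    by (intro is_CkI[where g' = "\<lambda>x v. g' x v + h' x v"] has_derivative_add Suc.IH)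
qed

lemma is_Ck_sum:
  assumes "\<And>i. i \<in> A \<Longrightarrow> is_Ck k S (g i)"
  shows "is_Ck k S (\<lambda>x. \<Sum>i\<in>A. g i x)"
  using assms by (induction A rule: infinite_finite_induct) (auto intro: is_Ck_const is_Ck_add)

lemma is_Ck_scaleR:
  assumes "is_Ck k S a" "is_Ck k S g"
  shows "is_Ck k S (\<lambda>x. a x *\<^sub>R g x)"
  using assms
proof (induction k arbitrary: a g)
  case 0
  then show ?case by (auto intro: continuous_on_scaleR)
next
  case (Suc k)
  from Suc.prems(1) obtain a' where
    "\<And>x. x \<in> S \<Longrightarrow> (a has_derivative a' x) (at x within S)" "\<And>v. is_Ck k S (\<lambda>x. a' x v)"
    by (auto simp: is_Ck.simps(2))
  moreover from Suc.prems(2) obtain g' where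
    "\<And>x. x \<in> S \<Longrightarrow> (g has_derivative g' x) (at x within S)" "\<And>v. is_Ck k S (\<lambda>x. g' x v)"
    by (auto simp: is_Ck.simps(2))
  ultimately show ?case
    using Suc.prems
    by (intro is_CkI[where g' = "\<lambda>x v. a x *\<^sub>R g' x v + a' x v *\<^sub>R g x"]
        has_derivative_scaleR is_Ck_add Suc.IH) (auto dest: is_Ck_SucD)
qed

lemma is_Ck_power: "is_Ck k S a \<Longrightarrow> is_Ck k S (\<lambda>x. a x ^ n)" for a :: "_ \<Rightarrow> real"
proof (induction n)
  case (Suc n)
  then show ?case using is_Ck_scaleR[of k S a "\<lambda>x. a x ^ n"] by simp
qed (simp add: is_Ck_const)

text \<open>
  The chain rule gives \<open>f' (g x) (g' x v)\<close>, in which the direction depends on \<open>x\<close>. Expanding it in the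
  basis yields products of scalar functions with derivatives of \<open>f\<close> in fixed directions, to which the
  induction hypothesis applies.
\<close>

lemma is_Ck_compose:
  fixes g :: "'a::euclidean_space \<Rightarrow> 'b::euclidean_space" and f :: "'b \<Rightarrow> 'c::real_normed_vector"
  assumes "is_Ck k T f" "is_Ck k S g" "g ` S \<subseteq> T"
  shows "is_Ck k S (\<lambda>x. f (g x))"
  using assms(1,2)
proof (induction k arbitrary: f)
  case 0
  then show ?case using assms(3) by (auto intro: continuous_on_compose2)
next
  case (Suc k)
  from Suc.prems(1) obtain f' where
    Df: "\<And>y. y \<in> T \<Longrightarrow> (f has_derivative f' y) (at y within T)" "\<And>v. is_Ck k T (\<lambda>y. f' y v)"
    by (auto simp: is_Ck.simps(2))
  from Suc.prems(2) obtain g' where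
    Dg: "\<And>x. x \<in> S \<Longrightarrow> (g has_derivative g' x) (at x within S)" "\<And>v. is_Ck k S (\<lambda>x. g' x v)"
    by (auto simp: is_Ck.simps(2))
  show ?case
  proof (rule is_CkI)
    show "((\<lambda>x. f (g x)) has_derivative (\<lambda>v. f' (g x) (g' x v))) (at x within S)" if "x \<in> S" for x
      by (rule has_derivative_in_compose2[OF Df(1) assms(3) that Dg(1)[OF that]])
    fix v
    have "is_Ck k S (\<lambda>x. \<Sum>b\<in>Basis. (g' x v \<bullet> b) *\<^sub>R f' (g x) b)"
    proof (intro is_Ck_sum is_Ck_scaleR)
      show "is_Ck k S (\<lambda>x. g' x v \<bullet> b)" for b
        by (rule is_Ck_bounded_linear[OF bounded_linear_inner_left Dg(2)])
      show "is_Ck k S (\<lambda>x. f' (g x) b)" for b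
        by (rule Suc.IH[OF Df(2) is_Ck_SucD[OF Suc.prems(2)]])
    qed
    then show "is_Ck k S (\<lambda>x. f' (g x) (g' x v))"
    proof (rule is_Ck_cong)
      fix x assume "x \<in> S"
      with assms(3) Df(1)[of "g x"] have "linear (f' (g x))"
        by (auto simp: image_subset_iff dest: has_derivative_linear)
      from linear_sum[OF this, of "\<lambda>b. (g' x v \<bullet> b) *\<^sub>R b" Basis]
      show "f' (g x) (g' x v) = (\<Sum>b\<in>Basis. (g' x v \<bullet> b) *\<^sub>R f' (g x) b)"
        by (simp add: euclidean_representation linear_scale[OF \<open>linear (f' (g x))\<close>])
    qed
  qed
qed

lemma is_Ck_Lipschitz_on_cball:
  fixes f :: "'a::euclidean_space \<Rightarrow> 'b::real_normed_vector"
  assumes "is_Ck (Suc k) UNIV f"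
  obtains L where "0 \<le> L" "\<And>x y. norm x \<le> A \<Longrightarrow> norm y \<le> A \<Longrightarrow> norm (f x - f y) \<le> L * norm (x - y)"
proof -
  from assms obtain f' where f': "\<And>x. (f has_derivative f' x) (at x)" "\<And>v. is_Ck k UNIV (\<lambda>x. f' x v)"
    by (rule is_CkE) auto
  have "\<exists>B. \<forall>x\<in>cball 0 A. norm (f' x b) \<le> B" for b
  proof -
    have "compact ((\<lambda>x. f' x b) ` cball 0 A)"
      using is_Ck_continuous[OF f'(2)] by (intro compact_continuous_image) (auto intro: continuous_on_subset)
    then show ?thesis
      using compact_imp_bounded bounded_iff by (metis imageI)
  qed
  then obtain B where B: "\<And>b x. norm x \<le> A \<Longrightarrow> norm (f' x b) \<le> B b"
    by (metis mem_cball_0)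
  define L where "L = (\<Sum>b\<in>(Basis::'a set). \<bar>B b\<bar>)"
  show thesis
  proof
    show "0 \<le> L" unfolding L_def by (intro sum_nonneg) auto
    fix x y :: 'a assume xy: "norm x \<le> A" "norm y \<le> A"
    show "norm (f x - f y) \<le> L * norm (x - y)"
    proof (rule differentiable_bound[where S = "cball 0 A"])
      show "(f has_derivative f' z) (at z within cball 0 A)" for z
        using f'(1) by (rule has_derivative_at_withinI)
      fix z :: 'a assume z: "z \<in> cball 0 A"
      show "onorm (f' z) \<le> L"
      proof (rule onorm_bound)
        fix v
        have lin: "linear (f' z)" using f'(1) by (rule has_derivative_linear)
        have "f' z v = (\<Sum>b\<in>Basis. (v \<bullet> b) *\<^sub>R f' z b)"
          using linear_sum[OF lin, of "\<lambda>b. (v \<bullet> b) *\<^sub>R b" Basis]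
          by (simp add: euclidean_representation linear_scale[OF lin])
        also have "norm \<dots> \<le> (\<Sum>b\<in>(Basis::'a set). norm v * \<bar>B b\<bar>)"
        proof (rule sum_norm_le)
          fix b :: 'a assume "b \<in> Basis"
          then show "norm ((v \<bullet> b) *\<^sub>R f' z b) \<le> norm v * \<bar>B b\<bar>"
            using B[of z b] z by (auto intro!: mult_mono Basis_le_norm)
        qed
        also have "\<dots> = L * norm v"
          by (simp add: L_def sum_distrib_left mult.commute)
        finally show "norm (f' z v) \<le> L * norm v" .
      qed (simp add: \<open>0 \<le> L\<close>)
    qed (use xy in auto)
  qed
qed

section \<open>Partial derivatives\<close>

text \<open>
  A relation rather than an operator, since the derivative within \<open>S\<close> need not be unique at this
  generality.
\<close>

definition partial_deriv ::
    "'a::euclidean_space set \<Rightarrow> 'a \<Rightarrow> ('a \<Rightarrow> 'b::real_normed_vector) \<Rightarrow> ('a \<Rightarrow> 'b) \<Rightarrow> bool" where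
  "partial_deriv S v g d \<longleftrightarrow>
     (\<exists>g'. \<forall>p\<in>S. (g has_derivative g' p) (at p within S) \<and> d p = g' p v)"

lemma partial_deriv_curve:
  assumes "partial_deriv S v g d" "c ` J \<subseteq> S" "s \<in> J"
    and "(c has_vector_derivative v) (at s within J)"
  shows "((\<lambda>s. g (c s)) has_vector_derivative d (c s)) (at s within J)"
proof -
  from assms(1) obtain g' where
    g': "\<And>p. p \<in> S \<Longrightarrow> (g has_derivative g' p) (at p within S)" "\<And>p. p \<in> S \<Longrightarrow> d p = g' p v"
    unfolding partial_deriv_def by blast
  have cs: "c s \<in> S" using assms by auto
  have "((\<lambda>s. g (c s)) has_derivative (\<lambda>h. g' (c s) (h *\<^sub>R v))) (at s within J)"
    using assms(4) unfolding has_vector_derivative_def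
    by (intro has_derivative_in_compose2[OF g'(1) assms(2,3)])
  moreover have "linear (g' (c s))" using g'(1)[OF cs] by (rule has_derivative_linear)
  ultimately show ?thesis
    unfolding has_vector_derivative_def by (simp add: linear_scale g'(2)[OF cs])
qed

lemma is_Ck_partial_deriv:
  assumes "is_Ck (Suc k) S g"
  obtains d where "partial_deriv S v g d" "is_Ck k S d"
proof -
  from assms obtain g' where
    "\<And>x. x \<in> S \<Longrightarrow> (g has_derivative g' x) (at x within S)" "\<And>v. is_Ck k S (\<lambda>x. g' x v)"
    by (auto simp: is_Ck.simps(2))
  then show thesis
    by (intro that[of "\<lambda>p. g' p v"]) (auto simp: partial_deriv_def)
qed

lemma is_Ck_partial_derivs:
  assumes "is_Ck n S g"
  shows "\<exists>D. D 0 = g \<and> (\<forall>j\<le>n. is_Ck (n - j) S (D j)) \<and> (\<forall>j<n. partial_deriv S v (D j) (D (Suc j)))"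
  using assms
proof (induction n arbitrary: g)
  case 0
  then show ?case by auto
next
  case (Suc n)
  from Suc.prems obtain d where d: "partial_deriv S v g d" "is_Ck n S d"
    by (rule is_Ck_partial_deriv)
  from Suc.IH[OF d(2)] obtain D where D: "D 0 = d" "\<And>j. j \<le> n \<Longrightarrow> is_Ck (n - j) S (D j)"
    "\<And>j. j < n \<Longrightarrow> partial_deriv S v (D j) (D (Suc j))" by auto
  show ?case
    by (rule exI[of _ "case_nat g D"]) (use Suc.prems d D in \<open>auto split: nat.splits\<close>)
qed

text \<open>
  Symmetry of second derivatives on a strip: one variable is free and the other may range over an
  interval that contains an endpoint. The second difference of \<open>g\<close> over the rectangle with corners
  \<open>(x, t)\<close> and \<open>(y, s)\<close> differs from \<open>(s - t) (y - x)\<close> times the mixed derivative at the corner by at most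
  \<open>e \<bar>s - t\<bar> \<bar>y - x\<bar>\<close>; letting \<open>y\<close> tend to \<open>x\<close> gives the difference quotient of \<open>gx\<close>.
\<close>

lemma mixed_partials:
  fixes g :: "real \<Rightarrow> real \<Rightarrow> 'b::real_normed_vector"
  assumes J: "is_interval J" "t \<in> J"
    and gx: "\<And>s. s \<in> J \<Longrightarrow> ((\<lambda>y. g y s) has_vector_derivative gx s) (at x)"
    and gt: "\<And>y s. s \<in> J \<Longrightarrow> ((\<lambda>s. g y s) has_vector_derivative gt y s) (at s within J)"
    and gtx: "\<And>y s. s \<in> J \<Longrightarrow> ((\<lambda>y. gt y s) has_vector_derivative gtx y s) (at y)"
    and cont: "continuous_on (UNIV \<times> J) (\<lambda>(y, s). gtx y s)"
  shows "(gx has_vector_derivative gtx x t) (at t within J)"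
  unfolding has_vector_derivative_def has_derivative_within_alt
proof (intro conjI allI impI)
  show "bounded_linear (\<lambda>h. h *\<^sub>R gtx x t)" by (rule bounded_linear_scaleR_left)
  fix e :: real assume "0 < e"
  from cont J(2) have "continuous (at (x, t) within UNIV \<times> J) (\<lambda>(y, s). gtx y s)"
    by (simp add: continuous_on_eq_continuous_within)
  then have "\<exists>d>0. \<forall>p\<in>UNIV \<times> J. dist p (x, t) < d \<longrightarrow> dist (case p of (y, s) \<Rightarrow> gtx y s) (gtx x t) < e"
    using \<open>0 < e\<close> unfolding continuous_within_eps_delta by simp
  then obtain d where d: "0 < d" and
    D0: "\<forall>p\<in>UNIV \<times> J. dist p (x, t) < d \<longrightarrow> dist (case p of (y, s) \<Rightarrow> gtx y s) (gtx x t) < e"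
    by blast
  have D: "dist (gtx y s) (gtx x t) < e" if "s \<in> J" "dist (y, s) (x, t) < d" for y s
    using D0[THEN bspec, of "(y, s)"] that by simp
  have close: "norm (gtx y s - gtx x t) \<le> e" if "s \<in> J" "\<bar>y - x\<bar> < d / 2" "\<bar>s - t\<bar> < d / 2" for y s
  proof -
    have "dist (y, s) (x, t) \<le> \<bar>y - x\<bar> + \<bar>s - t\<bar>"
      unfolding dist_Pair_Pair dist_real_def by (rule sqrt_sum_squares_le_sum_abs[THEN order_trans]) simp
    then show ?thesis using D[OF that(1), of y] that by (simp add: dist_norm)
  qed
  show "\<exists>d>0. \<forall>s\<in>J. norm (s - t) < d \<longrightarrow>
      norm (gx s - gx t - (s - t) *\<^sub>R gtx x t) \<le> e * norm (s - t)"
  proof (intro exI[of _ "d / 2"] conjI ballI impI)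
    fix s assume s: "s \<in> J" "norm (s - t) < d / 2"
    let ?T = "closed_segment t s" and ?Y = "{x - d / 2<..<x + d / 2}"
    let ?L = "gtx x t"
    have T: "?T \<subseteq> J"
      using J s by (intro closed_segment_subset is_interval_convex)
    have Td: "\<bar>r - t\<bar> < d / 2" if "r \<in> ?T" for r
      using that s(2) by (auto simp: closed_segment_eq_real_ivl split: if_splits)
    have dif: "norm (g y s - g x s - (g y t - g x t) - ((s - t) * (y - x)) *\<^sub>R ?L)
        \<le> (e * \<bar>s - t\<bar>) * \<bar>y - x\<bar>" if y: "y \<in> ?Y" for y
    proof -
      have "norm ((g y s - g x s - ((y - x) * s) *\<^sub>R ?L) - (g y t - g x t - ((y - x) * t) *\<^sub>R ?L))
          \<le> (e * \<bar>y - x\<bar>) * \<bar>s - t\<bar>"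
      proof (rule vector_mean_value_bound[where J = ?T])
        fix r assume r: "r \<in> ?T"
        then have rJ: "r \<in> J" using T by auto
        show "((\<lambda>r. g y r - g x r - ((y - x) * r) *\<^sub>R ?L) has_vector_derivative
            gt y r - gt x r - (y - x) *\<^sub>R ?L) (at r within ?T)"
        proof -
          have "((\<lambda>r. g z r) has_vector_derivative gt z r) (at r within ?T)" for z
            using gt[OF rJ] T by (rule has_vector_derivative_within_subset)
          moreover have "((\<lambda>r. ((y - x) * r) *\<^sub>R ?L) has_vector_derivative (y - x) *\<^sub>R ?L) (at r within ?T)"
            by (auto simp: has_vector_derivative_def intro!: derivative_eq_intros)
          ultimately show ?thesis by (intro has_vector_derivative_diff)
        qed
        have "norm ((gt y r - y *\<^sub>R ?L) - (gt x r - x *\<^sub>R ?L)) \<le> e * \<bar>y - x\<bar>"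
        proof (rule vector_mean_value_bound[where J = ?Y])
          fix z assume z: "z \<in> ?Y"
          have "((\<lambda>y. y *\<^sub>R ?L) has_vector_derivative ?L) (at z)"
            by (auto simp: has_vector_derivative_def intro!: derivative_eq_intros)
          from has_vector_derivative_diff[OF gtx[OF rJ] this]
          show "((\<lambda>y. gt y r - y *\<^sub>R ?L) has_vector_derivative gtx z r - ?L) (at z within ?Y)"
            by (rule has_vector_derivative_at_within)
          show "norm (gtx z r - ?L) \<le> e"
            using close[OF rJ _ Td[OF r]] z by (simp add: abs_if)
        qed (use y d in auto)
        then show "norm (gt y r - gt x r - (y - x) *\<^sub>R ?L) \<le> e * \<bar>y - x\<bar>"
          by (simp add: algebra_simps)
      qed auto
      then show ?thesis by (simp add: algebra_simps)
    qed
    define \<phi> where "\<phi> y = (g y s - g y t) - ((s - t) * y) *\<^sub>R ?L" for y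
    have lip: "norm (\<phi> y - \<phi> x) \<le> (e * \<bar>s - t\<bar>) * \<bar>y - x\<bar>" if "y \<in> ?Y" for y
      using dif[OF that] by (simp add: \<phi>_def algebra_simps)
    have der: "(\<phi> has_vector_derivative (gx s - gx t - (s - t) *\<^sub>R ?L)) (at x)"
    proof -
      have "((\<lambda>y. ((s - t) * y) *\<^sub>R ?L) has_vector_derivative (s - t) *\<^sub>R ?L) (at x)"
        by (auto simp: has_vector_derivative_def intro!: derivative_eq_intros)
      then show ?thesis
        unfolding \<phi>_def using gx[OF s(1)] gx[OF J(2)] by (intro has_vector_derivative_diff)
    qed
    have "norm (gx s - gx t - (s - t) *\<^sub>R ?L) \<le> e * \<bar>s - t\<bar>"
    proof (rule norm_vector_derivative_le[OF der])
      fix y assume "\<bar>y - x\<bar> < d / 2"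
      then have "y \<in> ?Y" by (auto simp: abs_if split: if_splits)
      then show "norm (\<phi> y - \<phi> x) \<le> e * \<bar>s - t\<bar> * \<bar>y - x\<bar>" by (rule lip)
    qed (use d in simp)
    then show "norm (gx s - gx t - (s - t) *\<^sub>R gtx x t) \<le> e * norm (s - t)" by simp
  qed (use d in auto)
qed

lemma partial_deriv_cong:
  "partial_deriv S v g d \<Longrightarrow> (\<And>p. p \<in> S \<Longrightarrow> d' p = d p) \<Longrightarrow> partial_deriv S v g d'"
  unfolding partial_deriv_def by metis

lemma partial_deriv_minus:
  assumes "partial_deriv S v g d"
  shows "partial_deriv S v (\<lambda>p. - g p) (\<lambda>p. - d p)"
proof -
  from assms obtain g' where "\<forall>p\<in>S. (g has_derivative g' p) (at p within S) \<and> d p = g' p v"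
    unfolding partial_deriv_def by auto
  then show ?thesis
    unfolding partial_deriv_def by (intro exI[of _ "\<lambda>p v. - g' p v"]) (auto intro: has_derivative_minus)
qed

text \<open>
  The set \<open>J\<close> parametrises the part of the line through \<open>p\<close> in direction \<open>w\<close> that is used; it may be
  one-sided, so boundary points of \<open>S\<close> are covered.
\<close>

lemma partial_derivs_commute:
  fixes g :: "'a::euclidean_space \<Rightarrow> 'b::real_normed_vector"
  assumes v: "partial_deriv S v g gv" and w: "partial_deriv S w g gw"
    and vw: "partial_deriv S w gv gvw" and wv: "partial_deriv S v gw gwv"
    and cont: "continuous_on S gwv" and p: "p \<in> S"
    and J: "is_interval J" "0 \<in> J" "at 0 within J \<noteq> bot"
    and rect: "\<And>y s. s \<in> J \<Longrightarrow> p + y *\<^sub>R v + s *\<^sub>R w \<in> S"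
  shows "gvw p = gwv p"
proof -
  let ?c = "\<lambda>y s. p + y *\<^sub>R v + s *\<^sub>R w"
  have cv: "((\<lambda>y. ?c y s) has_vector_derivative v) (at y)" for y s
    by (auto simp: has_vector_derivative_def intro!: derivative_eq_intros)
  have cw: "((\<lambda>s. ?c y s) has_vector_derivative w) (at s within J)" for y s
    by (auto simp: has_vector_derivative_def intro!: derivative_eq_intros)
  have "((\<lambda>s. gv (?c 0 s)) has_vector_derivative gwv (?c 0 0)) (at 0 within J)"
  proof (rule mixed_partials[where g = "\<lambda>y s. g (?c y s)" and gt = "\<lambda>y s. gw (?c y s)"
        and gtx = "\<lambda>y s. gwv (?c y s)" and gx = "\<lambda>s. gv (?c 0 s)"])
    show "((\<lambda>y. g (?c y s)) has_vector_derivative gv (?c 0 s)) (at 0)" if "s \<in> J" for s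
      by (rule partial_deriv_curve[where J = UNIV, OF v _ _ cv]) (use rect that in auto)
    show "((\<lambda>s. g (?c y s)) has_vector_derivative gw (?c y s)) (at s within J)" if "s \<in> J" for y s
      by (rule partial_deriv_curve[OF w _ _ cw]) (use rect that in auto)
    show "((\<lambda>y. gw (?c y s)) has_vector_derivative gwv (?c y s)) (at y)" if "s \<in> J" for y s
      by (rule partial_deriv_curve[where J = UNIV, OF wv _ _ cv]) (use rect that in auto)
    show "continuous_on (UNIV \<times> J) (\<lambda>(y, s). gwv (?c y s))"
      unfolding case_prod_beta
      by (rule continuous_on_compose2[OF cont]) (use rect in \<open>auto intro!: continuous_intros\<close>)
  qed (use J in auto)
  moreover have "((\<lambda>s. gv (?c 0 s)) has_vector_derivative gvw (?c 0 0)) (at 0 within J)"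
    by (rule partial_deriv_curve[OF vw _ _ cw]) (use rect[of _ 0] J in auto)
  ultimately have "gvw (?c 0 0) = gwv (?c 0 0)"
    by (intro vector_derivative_unique_within[OF J(3)])
  then show ?thesis by simp
qed

section \<open>Time derivatives of exact solutions\<close>

lemma time_interval_segment:
  assumes "time_interval I" "s \<in> I" "t \<in> I"
  shows "{s..t} \<subseteq> I"
  using assms by (meson atLeastAtMost_iff is_interval_1 subsetI time_interval_def)

lemma time_interval_at_within:
  assumes "time_interval I" "t \<in> I"
  shows "at t within I \<noteq> bot"
proof -
  from assms obtain s where s: "s \<in> I" "t < s" unfolding time_interval_def by blast
  then have "t islimpt {t..s}" by (simp add: islimpt_Icc)
  then show ?thesis
    using time_interval_segment[OF assms s(1)] islimpt_subset trivial_limit_within by blast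
qed

text \<open>
  A smooth solution through its derivatives: \<open>U l\<close> is the \<open>l\<close>-th time derivative of the solution and
  \<open>G k\<close> that of the flux \<open>f (U 0)\<close>. The last assumption is the conservation law differentiated \<open>k\<close>
  times in time.
\<close>

locale solution_jet =
  fixes f :: "'b::euclidean_space \<Rightarrow> 'b" and I :: "real set" and N :: nat
    and U G :: "nat \<Rightarrow> real \<times> real \<Rightarrow> 'b"
  assumes I: "time_interval I"
    and f: "is_Ck N UNIV f"
    and U_Ck: "\<And>l. l \<le> N \<Longrightarrow> is_Ck (N - l) (UNIV \<times> I) (U l)"
    and U_time: "\<And>l. l < N \<Longrightarrow> partial_deriv (UNIV \<times> I) (0, 1) (U l) (U (Suc l))"
    and G_0: "\<And>p. G 0 p = f (U 0 p)"
    and G_Ck: "\<And>k. k \<le> N \<Longrightarrow> is_Ck (N - k) (UNIV \<times> I) (G k)"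
    and G_time: "\<And>k. k < N \<Longrightarrow> partial_deriv (UNIV \<times> I) (0, 1) (G k) (G (Suc k))"
    and G_space: "\<And>k. Suc k < N \<Longrightarrow> partial_deriv (UNIV \<times> I) (1, 0) (G k) (\<lambda>p. - U (Suc k) p)"

lemma space_line: "((\<lambda>y. (y, t)) has_vector_derivative (1, 0)) (at y within T)"
  using has_derivative_Pair[OF has_derivative_ident has_derivative_const]
  by (simp add: has_vector_derivative_def)

lemma time_line: "((\<lambda>s. (x, s)) has_vector_derivative (0, 1)) (at s within T)"
  using has_derivative_Pair[OF has_derivative_const has_derivative_ident]
  by (simp add: has_vector_derivative_def)

text \<open>
  The conservation law is the case \<open>k = 0\<close> of the relation between \<open>G k\<close> and \<open>U (Suc k)\<close>. Differentiating
  the relation for \<open>k\<close> in time and exchanging the two derivatives of \<open>G k\<close> gives the relation for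
  \<open>Suc k\<close>.
\<close>

lemma smooth_solution_jet:
  fixes f :: "real^'m \<Rightarrow> real^'m"
  assumes I: "time_interval I" and f: "Ck_on N UNIV f" and u: "smooth_solution N f I u" and N: "2 \<le> N"
  obtains U G where "solution_jet f I N U G" "\<And>x t. U 0 (x, t) = u x t"
proof -
  let ?S = "UNIV \<times> I :: (real \<times> real) set"
  have Ck_f: "is_Ck N UNIV f" using f by (rule is_Ck_if_Ck_on)
  have Ck_u: "is_Ck N ?S (\<lambda>(x, t). u x t)"
    using u unfolding smooth_solution_def by (auto intro: is_Ck_if_Ck_on)
  from is_Ck_partial_derivs[OF Ck_u, of "(0, 1)"] obtain U where
    U_derivs: "U 0 = (\<lambda>(x, t). u x t) \<and> (\<forall>l\<le>N. is_Ck (N - l) ?S (U l)) \<and>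
      (\<forall>l<N. partial_deriv ?S (0, 1) (U l) (U (Suc l)))" ..
  then have U: "U 0 = (\<lambda>(x, t). u x t)" "\<And>l. l \<le> N \<Longrightarrow> is_Ck (N - l) ?S (U l)"
    "\<And>l. l < N \<Longrightarrow> partial_deriv ?S (0, 1) (U l) (U (Suc l))"
    by simp_all
  have Ck_G: "is_Ck N ?S (\<lambda>p. f (U 0 p))"
    using is_Ck_compose[OF Ck_f, of ?S "U 0"] U(2)[of 0] by simp
  from is_Ck_partial_derivs[OF Ck_G, of "(0, 1)"] obtain G where
    G_derivs: "G 0 = (\<lambda>p. f (U 0 p)) \<and> (\<forall>l\<le>N. is_Ck (N - l) ?S (G l)) \<and>
      (\<forall>l<N. partial_deriv ?S (0, 1) (G l) (G (Suc l)))" ..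
  then have G: "G 0 = (\<lambda>p. f (U 0 p))" "\<And>l. l \<le> N \<Longrightarrow> is_Ck (N - l) ?S (G l)"
    "\<And>l. l < N \<Longrightarrow> partial_deriv ?S (0, 1) (G l) (G (Suc l))"
    by simp_all
  have space: "partial_deriv ?S (1, 0) (G k) (\<lambda>p. - U (Suc k) p)" if "Suc k < N" for k
    using that
  proof (induction k)
    case 0
    have "is_Ck (Suc (N - 1)) ?S (G 0)" using G(2)[of 0] N by simp
    then obtain d where d: "partial_deriv ?S (1, 0) (G 0) d"
      by (rule is_Ck_partial_deriv)
    show ?case
    proof (rule partial_deriv_cong[OF d])
      fix p assume "p \<in> ?S"
      then obtain x t where p: "p = (x, t)" and t: "t \<in> I" by auto
      from u t obtain ut fx where
        ut: "((\<lambda>s. u x s) has_vector_derivative ut) (at t within I)" and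
        fx: "((\<lambda>y. f (u y t)) has_vector_derivative fx) (at x)" and eq: "ut + fx = 0"
        unfolding smooth_solution_def by blast
      have "((\<lambda>s. U 0 (x, s)) has_vector_derivative U (Suc 0) (x, t)) (at t within I)"
        by (rule partial_deriv_curve[OF U(3) _ _ time_line]) (use t N in auto)
      then have "ut = U (Suc 0) p"
        using ut vector_derivative_unique_within[OF time_interval_at_within[OF I t]] p U(1) by simp
      moreover have "((\<lambda>y. G 0 (y, t)) has_vector_derivative d (x, t)) (at x)"
        by (rule partial_deriv_curve[where J = UNIV, OF d _ _ space_line]) (use t in auto)
      then have "fx = d p"
        using fx vector_derivative_unique_at p U(1) G(1) by simp
      ultimately show "- U (Suc 0) p = d p" using eq by (simp add: minus_unique)
    qed
  next
    case (Suc k)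
    have "is_Ck (Suc (N - Suc k - 1)) ?S (G (Suc k))"
      using G(2)[of "Suc k"] Suc.prems by (simp add: Suc_diff_Suc)
    then obtain d where d: "partial_deriv ?S (1, 0) (G (Suc k)) d" "is_Ck (N - Suc k - 1) ?S d"
      by (rule is_Ck_partial_deriv)
    show ?case
    proof (rule partial_deriv_cong[OF d(1)])
      fix p assume "p \<in> ?S"
      then obtain x t where p: "p = (x, t)" and t: "t \<in> I" by auto
      \<comment> \<open>As \<open>t\<close> may be the first time in \<open>I\<close>, only times to its right are used.\<close>
      from I t obtain t' where t': "t' \<in> I" "t < t'" unfolding time_interval_def by blast
      let ?J = "{0..t' - t}"
      show "- U (Suc (Suc k)) p = d p"
      proof (rule partial_derivs_commute[where J = ?J and p = p and gwv = d
            and gvw = "\<lambda>p. - U (Suc (Suc k)) p"])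
        show "partial_deriv ?S (1, 0) (G k) (\<lambda>p. - U (Suc k) p)"
          using Suc by simp
        show "partial_deriv ?S (0, 1) (G k) (G (Suc k))"
          using Suc.prems by (intro G(3)) simp
        show "partial_deriv ?S (0, 1) (\<lambda>p. - U (Suc k) p) (\<lambda>p. - U (Suc (Suc k)) p)"
          using Suc.prems by (intro partial_deriv_minus U(3)) simp
        show "partial_deriv ?S (1, 0) (G (Suc k)) d" by (rule d(1))
        show "continuous_on ?S d" using d(2) by (rule is_Ck_continuous)
        show "at 0 within ?J \<noteq> bot"
          using t' by (simp add: trivial_limit_within islimpt_Icc)
        show "p + y *\<^sub>R (1, 0) + s *\<^sub>R (0, 1) \<in> ?S" if "s \<in> ?J" for y s
          using that p time_interval_segment[OF I t t'(1)] by auto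
      qed (use p t t' in \<open>auto simp: is_interval_cc\<close>)
    qed
  qed
  have "solution_jet f I N U G"
    by standard (use I Ck_f U G space in auto)
  then show thesis using U(1) by (intro that) auto
qed

section \<open>The flux along the Taylor polynomial of the solution\<close>

context solution_jet
begin

lemma taylor_model_Ck:
  assumes "k \<le> N"
  shows "is_Ck (N - k) ((UNIV \<times> I) \<times> UNIV) (\<lambda>z. f (taylor_poly k (\<lambda>l. U l (fst z)) (snd z)))"
proof (rule is_Ck_compose[OF is_Ck_mono[OF f]])
  show "is_Ck (N - k) ((UNIV \<times> I) \<times> UNIV) (\<lambda>z. taylor_poly k (\<lambda>l. U l (fst z)) (snd z))"
    unfolding taylor_poly_def
  proof (rule is_Ck_sum, rule is_Ck_scaleR)
    fix l assume "l \<in> {0..k}"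
    then show "is_Ck (N - k) ((UNIV \<times> I) \<times> UNIV) (\<lambda>z :: (real \<times> real) \<times> real. U l (fst z))"
      using assms
      by (intro is_Ck_compose[OF is_Ck_mono[OF U_Ck[of l]] is_Ck_linear[OF bounded_linear_fst]]) auto
    show "is_Ck (N - k) ((UNIV \<times> I) \<times> UNIV) (\<lambda>z :: (real \<times> real) \<times> real. snd z ^ l / fact l)"
      by (rule is_Ck_bounded_linear[OF bounded_linear_divide
            is_Ck_power[OF is_Ck_linear[OF bounded_linear_snd]]])
  qed
qed auto

text \<open>
  Here \<open>H j\<close> is the \<open>j\<close>-th derivative of \<open>f\<close> along the Taylor polynomial of degree \<open>k\<close>. That polynomial
  and the solution differ by \<open>O(s ^ (k + 1))\<close>, hence so do their images under \<open>f\<close>, and the derivatives up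
  to order \<open>k\<close> agree. This avoids any formula for higher derivatives of a composition.
\<close>

lemma taylor_model_derivative_at_0:
  assumes t: "t \<in> I" and k: "Suc k < N"
    and H_0: "\<And>\<rho>. H 0 \<rho> = f (taylor_poly k (\<lambda>l. U l (x, t)) \<rho>)"
    and H: "\<And>j \<rho>. j \<le> k \<Longrightarrow> (H j has_vector_derivative H (Suc j) \<rho>) (at \<rho>)"
    and H_cont: "continuous_on UNIV (H (Suc k))"
  shows "H k 0 = G k (x, t)"
proof -
  from I t obtain t' where t': "t' \<in> I" "t < t'" unfolding time_interval_def by blast
  define \<epsilon> where "\<epsilon> = t' - t"
  have \<epsilon>: "0 < \<epsilon>" using t' by (simp add: \<epsilon>_def)
  have inS: "(\<lambda>s. (x, t + s)) ` {0..\<epsilon>} \<subseteq> UNIV \<times> I"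
    using time_interval_segment[OF I t t'(1)] by (auto simp: \<epsilon>_def)
  have line: "((\<lambda>s. (x, t + s)) has_vector_derivative (0, 1)) (at s within {0..\<epsilon>})" for s
    using has_derivative_Pair[OF has_derivative_const has_derivative_add[OF has_derivative_const has_derivative_ident],
        of x t s "{0..\<epsilon>}"]
    by (simp add: has_vector_derivative_def)
  have U_line: "((\<lambda>s. U l (x, t + s)) has_vector_derivative U (Suc l) (x, t + s)) (at s within {0..\<epsilon>})"
    if "l < N" "s \<in> {0..\<epsilon>}" for l s
    by (rule partial_deriv_curve[OF U_time[OF that(1)] inS that(2) line])
  have G_line: "((\<lambda>s. G l (x, t + s)) has_vector_derivative G (Suc l) (x, t + s)) (at s within {0..\<epsilon>})"
    if "l < N" "s \<in> {0..\<epsilon>}" for l s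
    by (rule partial_deriv_curve[OF G_time[OF that(1)] inS that(2) line])
  let ?P = "taylor_poly k (\<lambda>l. U l (x, t))"
  have U_cont: "continuous_on {0..\<epsilon>} (\<lambda>s. U l (x, t + s))" if "l < N" for l
    using U_line[OF that] by (rule continuous_on_vector_derivative)
  have P_cont: "continuous_on {0..\<epsilon>} ?P"
    unfolding taylor_poly_def by (intro continuous_intros) auto
  obtain B where B: "\<And>s. s \<in> {0..\<epsilon>} \<Longrightarrow> norm (U (Suc k) (x, t + s)) \<le> B"
    using continuous_on_compact_bounded[OF U_cont[OF k] _ order_refl] by auto
  obtain A1 where A1: "\<And>s. s \<in> {0..\<epsilon>} \<Longrightarrow> norm (U 0 (x, t + s)) \<le> A1"
    using continuous_on_compact_bounded[OF U_cont[of 0] _ order_refl] k by auto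
  obtain A2 where A2: "\<And>s. s \<in> {0..\<epsilon>} \<Longrightarrow> norm (?P s) \<le> A2"
    using continuous_on_compact_bounded[OF P_cont _ order_refl] by auto
  have "is_Ck (Suc 0) UNIV f"
    using is_Ck_mono[OF f] k by simp
  then obtain L where L: "0 \<le> L"
    "\<And>a b. norm a \<le> max A1 A2 \<Longrightarrow> norm b \<le> max A1 A2 \<Longrightarrow> norm (f a - f b) \<le> L * norm (a - b)"
    by (rule is_Ck_Lipschitz_on_cball) blast
  have "H k 0 - G k (x, t + 0) = 0"
  proof (rule flat_jet[where W = "\<lambda>j s. H j s - G j (x, t + s)" and \<epsilon> = \<epsilon> and k = k and C = "L * B"])
    show "((\<lambda>s. H j s - G j (x, t + s)) has_vector_derivative H (Suc j) s - G (Suc j) (x, t + s))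
        (at s within {0..\<epsilon>})" if "j \<le> k" "0 \<le> s" "s \<le> \<epsilon>" for j s
      using that k by (intro has_vector_derivative_diff G_line has_vector_derivative_at_within[OF H]) auto
    show "continuous_on {0..\<epsilon>} (\<lambda>s. H (Suc k) s - G (Suc k) (x, t + s))"
      by (rule continuous_on_diff[OF continuous_on_subset[OF H_cont subset_UNIV]
            continuous_on_vector_derivative[OF G_line[OF k]]])
    fix s assume s: "0 \<le> s" "s \<le> \<epsilon>"
    have "norm (U 0 (x, t + s) - (\<Sum>j<Suc k. ((s - 0) ^ j / fact j) *\<^sub>R U j (x, t + 0))) \<le> B * \<bar>s - 0\<bar> ^ Suc k"
    proof (rule taylor_bound[where W = "\<lambda>l s. U l (x, t + s)" and J = "{0..\<epsilon>}"])
      show "norm (U (Suc k) (x, t + r)) \<le> B" if "r \<in> closed_segment 0 s" for r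
        using that s by (intro B) (auto simp: closed_segment_eq_real_ivl split: if_splits)
    qed (use s U_line k in auto)
    then have close: "norm (U 0 (x, t + s) - ?P s) \<le> B * s ^ Suc k"
      using s by (simp add: taylor_poly_def atLeast0AtMost lessThan_Suc_atMost)
    have "norm (H 0 s - G 0 (x, t + s)) \<le> L * norm (?P s - U 0 (x, t + s))"
      unfolding H_0 G_0 using s A1[of s] A2[of s] by (intro L(2)) auto
    also have "\<dots> \<le> L * (B * s ^ Suc k)"
      using close L(1) by (intro mult_left_mono) (simp_all add: norm_minus_commute)
    finally show "norm (H 0 s - G 0 (x, t + s)) \<le> L * B * s ^ Suc k"
      by (simp add: mult_ac)
  qed (use \<epsilon> in auto)
  then show ?thesis by simp
qed

text \<open>
  The function \<open>E j\<close> is the derivative of the flux along the Taylor polynomial, \<open>j\<close> times in the local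
  time \<open>\<rho>\<close> and once in \<open>x\<close>. It is constructed as the \<open>x\<close>-derivative of the \<open>j\<close>-th derivative in \<open>\<rho>\<close>,
  because the latter is known at \<open>\<rho> = 0\<close>; by symmetry the \<open>E j\<close> are also successive derivatives in \<open>\<rho>\<close>,
  as a Taylor expansion of \<open>E 0\<close> requires.
\<close>

lemma taylor_model_space_derivative:
  assumes k: "2 * k + 2 < N"
  obtains E where
    "\<And>j. j < N - k \<Longrightarrow> continuous_on ((UNIV \<times> I) \<times> UNIV) (E j)"
    "\<And>x t \<rho>. t \<in> I \<Longrightarrow>
      ((\<lambda>y. f (taylor_poly k (\<lambda>l. U l (y, t)) \<rho>)) has_vector_derivative E 0 ((x, t), \<rho>)) (at x)"
    "\<And>j x t \<rho>. t \<in> I \<Longrightarrow> Suc j < N - k \<Longrightarrow>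
      ((\<lambda>\<rho>. E j ((x, t), \<rho>)) has_vector_derivative E (Suc j) ((x, t), \<rho>)) (at \<rho>)"
    "\<And>x t. t \<in> I \<Longrightarrow> E k ((x, t), 0) = - U (Suc k) (x, t)"
proof -
  let ?S = "(UNIV \<times> I) \<times> UNIV :: ((real \<times> real) \<times> real) set"
  let ?x = "((1, 0), 0) :: (real \<times> real) \<times> real" and ?\<rho> = "((0, 0), 1) :: (real \<times> real) \<times> real"
  let ?n = "N - k"
  have "is_Ck ?n ?S (\<lambda>z. f (taylor_poly k (\<lambda>l. U l (fst z)) (snd z)))"
    using k by (intro taylor_model_Ck) simp
  from is_Ck_partial_derivs[OF this, of ?\<rho>] obtain H where
    H_derivs: "H 0 = (\<lambda>z. f (taylor_poly k (\<lambda>l. U l (fst z)) (snd z))) \<and>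
      (\<forall>j\<le>?n. is_Ck (?n - j) ?S (H j)) \<and> (\<forall>j<?n. partial_deriv ?S ?\<rho> (H j) (H (Suc j)))" ..
  then have H_0: "\<And>z. H 0 z = f (taylor_poly k (\<lambda>l. U l (fst z)) (snd z))"
    and H_Ck: "\<And>j. j \<le> ?n \<Longrightarrow> is_Ck (?n - j) ?S (H j)"
    and H_\<rho>: "\<And>j. j < ?n \<Longrightarrow> partial_deriv ?S ?\<rho> (H j) (H (Suc j))"
    by simp_all
  have "\<exists>e. j < ?n \<longrightarrow> partial_deriv ?S ?x (H j) e \<and> is_Ck (?n - Suc j) ?S e" for j
  proof (cases "j < ?n")
    case True
    then have "is_Ck (Suc (?n - Suc j)) ?S (H j)"
      using H_Ck[of j] by (simp add: Suc_diff_Suc)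
    then obtain e where "partial_deriv ?S ?x (H j) e" "is_Ck (?n - Suc j) ?S e"
      by (rule is_Ck_partial_deriv)
    then show ?thesis by blast
  qed simp
  then have "\<exists>E. \<forall>j. j < ?n \<longrightarrow> partial_deriv ?S ?x (H j) (E j) \<and> is_Ck (?n - Suc j) ?S (E j)"
    by (intro choice allI)
  then obtain E where E_x: "\<And>j. j < ?n \<Longrightarrow> partial_deriv ?S ?x (H j) (E j)"
    and E_Ck: "\<And>j. j < ?n \<Longrightarrow> is_Ck (?n - Suc j) ?S (E j)" by auto
  have x_line: "((\<lambda>y. ((y, t), \<rho>)) has_vector_derivative ?x) (at x)" for x t \<rho> :: real
    using has_derivative_Pair[OF has_derivative_Pair[OF has_derivative_ident has_derivative_const] has_derivative_const,
        of t \<rho> x UNIV]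
    by (simp add: has_vector_derivative_def zero_prod_def)
  have \<rho>_line: "((\<lambda>\<rho>. ((x, t), \<rho>)) has_vector_derivative ?\<rho>) (at \<rho>)" for x t \<rho> :: real
    using has_derivative_Pair[OF has_derivative_const has_derivative_ident, of "(x, t)" \<rho> UNIV]
    by (simp add: has_vector_derivative_def zero_prod_def)
  have along_x: "((\<lambda>y. g ((y, t), \<rho>)) has_vector_derivative d ((x, t), \<rho>)) (at x)"
    if "partial_deriv ?S ?x g d" "t \<in> I" for g d :: "(real \<times> real) \<times> real \<Rightarrow> 'b" and x t \<rho>
    by (rule partial_deriv_curve[where J = UNIV, OF that(1) _ _ x_line]) (use that(2) in auto)
  have along_\<rho>: "((\<lambda>\<rho>. g ((x, t), \<rho>)) has_vector_derivative d ((x, t), \<rho>)) (at \<rho>)"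
    if "partial_deriv ?S ?\<rho> g d" "t \<in> I" for g d :: "(real \<times> real) \<times> real \<Rightarrow> 'b" and x t \<rho>
    by (rule partial_deriv_curve[where J = UNIV, OF that(1) _ _ \<rho>_line]) (use that(2) in auto)
  have E_cont: "continuous_on ?S (E j)" if "j < ?n" for j
    using E_Ck[OF that] by (rule is_Ck_continuous)
  have E_\<rho>: "((\<lambda>\<rho>. E j ((x, t), \<rho>)) has_vector_derivative E (Suc j) ((x, t), \<rho>)) (at \<rho>)"
    if t: "t \<in> I" and j: "Suc j < ?n" for j x t \<rho>
  proof -
    have "is_Ck (Suc (?n - Suc (Suc j))) ?S (E j)"
      using E_Ck[of j] j by (simp add: Suc_diff_Suc)
    then obtain e where e: "partial_deriv ?S ?\<rho> (E j) e"
      by (rule is_Ck_partial_deriv)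
    have "e ((x, t), \<rho>) = E (Suc j) ((x, t), \<rho>)"
    proof (rule partial_derivs_commute[where J = UNIV and gvw = e and gwv = "E (Suc j)" and p = "((x, t), \<rho>)"])
      show "partial_deriv ?S ?x (H j) (E j)" using j by (intro E_x) simp
      show "partial_deriv ?S ?\<rho> (H j) (H (Suc j))" using j by (intro H_\<rho>) simp
      show "partial_deriv ?S ?\<rho> (E j) e" by (rule e)
      show "partial_deriv ?S ?x (H (Suc j)) (E (Suc j))" using j by (rule E_x)
      show "continuous_on ?S (E (Suc j))" using j by (rule E_cont)
    qed (use t in auto)
    then show ?thesis using along_\<rho>[OF e t, of x \<rho>] by simp
  qed
  have E_0: "E k ((x, t), 0) = - U (Suc k) (x, t)" if t: "t \<in> I" for x t
  proof -
    have "H k ((y, t), 0) = G k (y, t)" for y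
    proof (rule taylor_model_derivative_at_0[where H = "\<lambda>j \<rho>. H j ((y, t), \<rho>)"])
      show "continuous_on UNIV (\<lambda>\<rho>. H (Suc k) ((y, t), \<rho>))"
        using k t by (intro continuous_on_compose2[OF is_Ck_continuous[OF H_Ck[of "Suc k"]]])
          (auto intro!: continuous_intros)
    qed (use t k H_0 in \<open>auto intro!: along_\<rho> H_\<rho>\<close>)
    moreover have "((\<lambda>y. H k ((y, t), 0)) has_vector_derivative E k ((x, t), 0)) (at x)"
      using k by (intro along_x E_x t) simp
    moreover have "((\<lambda>y. G k (y, t)) has_vector_derivative - U (Suc k) (x, t)) (at x)"
      by (rule partial_deriv_curve[where J = UNIV, OF G_space _ _ space_line]) (use t k in auto)
    ultimately show ?thesis using vector_derivative_unique_at by fastforce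
  qed
  show thesis
  proof (rule that[of E])
    show "((\<lambda>y. f (taylor_poly k (\<lambda>l. U l (y, t)) \<rho>)) has_vector_derivative E 0 ((x, t), \<rho>)) (at x)"
      if "t \<in> I" for x t \<rho>
      using along_x[OF E_x[of 0] that, of \<rho> x] k by (simp add: H_0)
  qed (use E_cont E_\<rho> E_0 in auto)
qed

end

section \<open>One step of the recursion\<close>

lemma eventually_small:
  fixes c :: real
  shows "\<forall>\<^sub>F h in at_right 0. 0 < h \<and> h < 1 \<and> c * h \<le> 1"
  unfolding eventually_at_right_field
proof (intro exI[of _ "1 / (\<bar>c\<bar> + 1)"] conjI allI impI)
  fix h :: real assume h: "0 < h" "h < 1 / (\<bar>c\<bar> + 1)"
  then have lt: "(\<bar>c\<bar> + 1) * h < 1" by (simp add: field_simps)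
  have "\<bar>c\<bar> * h \<ge> 0" "c * h \<le> \<bar>c\<bar> * h" using h by (auto intro: mult_right_mono)
  with lt show "h < 1" "c * h \<le> 1" by (simp_all add: algebra_simps) (use h in linarith)+
qed simp_all

text \<open>
  All points within spatial distance 1 of a point of \<open>K\<close> at the same time: room for the stencils.
\<close>

definition thicken :: "(real \<times> real) set \<Rightarrow> (real \<times> real) set" where
  "thicken K = (\<lambda>((x, t), s). (x + s, t)) ` (K \<times> {-1..1})"

lemma compact_thicken: "compact K \<Longrightarrow> compact (thicken K)"
  unfolding thicken_def
  by (intro compact_continuous_image compact_Times) (auto simp: case_prod_beta intro!: continuous_intros)

lemma thickenI: "(x, t) \<in> K \<Longrightarrow> \<bar>s\<bar> \<le> 1 \<Longrightarrow> (x + s, t) \<in> thicken K"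
  unfolding thicken_def by (force intro: image_eqI[of _ _ "((x, t), s)"])

lemma thicken_subset: "K \<subseteq> UNIV \<times> I \<Longrightarrow> thicken K \<subseteq> UNIV \<times> I"
  unfolding thicken_def by auto

context solution_jet
begin

text \<open>
  The approximation of the \<open>k\<close>-th time derivative of the flux that the scheme would compute from
  exact time derivatives at a single point \<open>p = (x, t)\<close>.
\<close>

definition model_time_diff :: "nat \<Rightarrow> nat \<Rightarrow> real \<Rightarrow> real \<times> real \<Rightarrow> 'b" where
  "model_time_diff k q \<delta> p =
     central_diff \<delta> k q (grid_fun 0 \<delta> (\<lambda>\<rho>. f (taylor_poly k (\<lambda>l. U l p) \<rho>)))"

text \<open>
  The estimate is for the \<open>x\<close>-derivative of the model, not for the model itself, since the model is
  about to be differenced in space. Differentiation in \<open>x\<close> commutes with the linear operator in time.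
\<close>

lemma model_time_diff_consistent:
  assumes kq: "1 \<le> k" "1 \<le> q" and N: "2 * k + 2 * q + 2 < N"
    and K: "compact K" "K \<subseteq> UNIV \<times> I"
  obtains C where "\<And>\<delta> x t. 0 < \<delta> \<Longrightarrow> of_int (fd_radius k q) * \<delta> \<le> 1 \<Longrightarrow> (x, t) \<in> K \<Longrightarrow>
    \<exists>d. ((\<lambda>y. model_time_diff k q \<delta> (y, t)) has_vector_derivative d) (at x) \<and>
      norm (d + U (Suc k) (x, t)) \<le> C * \<delta> ^ (2 * q)"
proof -
  have "2 * k + 2 < N" using N by simp
  then obtain E where
    E_cont: "\<And>j. j < N - k \<Longrightarrow> continuous_on ((UNIV \<times> I) \<times> UNIV) (E j)" and
    E_x: "\<And>x t \<rho>. t \<in> I \<Longrightarrow>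
      ((\<lambda>y. f (taylor_poly k (\<lambda>l. U l (y, t)) \<rho>)) has_vector_derivative E 0 ((x, t), \<rho>)) (at x)" and
    E_\<rho>: "\<And>j x t \<rho>. t \<in> I \<Longrightarrow> Suc j < N - k \<Longrightarrow>
      ((\<lambda>\<rho>. E j ((x, t), \<rho>)) has_vector_derivative E (Suc j) ((x, t), \<rho>)) (at \<rho>)" and
    E_k: "\<And>x t. t \<in> I \<Longrightarrow> E k ((x, t), 0) = - U (Suc k) (x, t)"
    by (rule taylor_model_space_derivative) blast
  have order: "k + 2 * q < N - k" using N by simp
  have box: "K \<times> {-1..1 :: real} \<subseteq> (UNIV \<times> I) \<times> UNIV" using K(2) by auto
  obtain B where B: "\<And>z. z \<in> K \<times> {-1..1} \<Longrightarrow> norm (E (k + 2 * q) z) \<le> B"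
    by (rule continuous_on_compact_bounded[OF E_cont[OF order] compact_Times[OF K(1) compact_Icc] box]) blast
  show thesis
  proof (rule that[of "fd_weight_norm k q (k + 2 * q) * B"])
    fix \<delta> x t :: real
    assume \<delta>: "0 < \<delta>" "of_int (fd_radius k q) * \<delta> \<le> 1" and xt: "(x, t) \<in> K"
    have t: "t \<in> I" using xt K(2) by auto
    let ?d = "central_diff \<delta> k q (grid_fun 0 \<delta> (\<lambda>\<rho>. E 0 ((x, t), \<rho>)))"
    have "((\<lambda>y. model_time_diff k q \<delta> (y, t)) has_vector_derivative ?d) (at x)"
      unfolding model_time_diff_def central_diff_def grid_fun_def
      by (intro bounded_linear.has_vector_derivative[OF bounded_linear_scaleR_right]
          has_vector_derivative_sum E_x t)
    moreover have "norm (?d - E k ((x, t), 0)) \<le> fd_weight_norm k q (k + 2 * q) * B * \<delta> ^ (2 * q)"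
      by (rule central_diff_consistent[where W = "\<lambda>j \<rho>. E j ((x, t), \<rho>)" and r = 1])
        (use kq \<delta> xt t N in \<open>auto intro!: E_\<rho> B\<close>)
    ultimately show "\<exists>d. ((\<lambda>y. model_time_diff k q \<delta> (y, t)) has_vector_derivative d) (at x) \<and>
        norm (d + U (Suc k) (x, t)) \<le> fd_weight_norm k q (k + 2 * q) * B * \<delta> ^ (2 * q)"
      using E_k[OF t] by (intro exI[of _ ?d]) simp
  qed
qed

lemma flux_space_diff_consistent:
  assumes q: "1 \<le> q" and N: "k + 2 * q + 2 < N"
    and K: "compact K" "K \<subseteq> UNIV \<times> I"
  obtains C where "\<And>h x t. 0 < h \<Longrightarrow> of_int (fd_radius 1 q) * h \<le> 1 \<Longrightarrow> (x, t) \<in> K \<Longrightarrow>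
    norm (central_diff h 1 q (grid_fun 0 h (\<lambda>s. G k (x + s, t))) + U (Suc k) (x, t)) \<le> C * h ^ (2 * q)"
proof -
  let ?S = "UNIV \<times> I :: (real \<times> real) set"
  have "is_Ck (N - k) ?S (G k)" using N by (intro G_Ck) simp
  from is_Ck_partial_derivs[OF this, of "(1, 0)"] obtain D where
    D_derivs: "D 0 = G k \<and> (\<forall>j\<le>N - k. is_Ck (N - k - j) ?S (D j)) \<and>
      (\<forall>j<N - k. partial_deriv ?S (1, 0) (D j) (D (Suc j)))" ..
  have D: "((\<lambda>s. D j (x + s, t)) has_vector_derivative D (Suc j) (x + s, t)) (at s)"
    if "j < N - k" "t \<in> I" for j x s t
  proof (rule partial_deriv_curve[where J = UNIV and S = ?S])
    show "partial_deriv ?S (1, 0) (D j) (D (Suc j))" using D_derivs that by blast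
    show "((\<lambda>s. (x + s, t)) has_vector_derivative (1, 0)) (at s)"
      using has_derivative_Pair[OF has_derivative_add[OF has_derivative_const has_derivative_ident] has_derivative_const,
          of x t s UNIV]
      by (simp add: has_vector_derivative_def)
  qed (use that in auto)
  have D_x: "partial_deriv ?S (1, 0) (G k) (D 1)"
    using D_derivs[THEN conjunct2, THEN conjunct2, rule_format, of 0] D_derivs N by simp
  have D_1: "D 1 (x, t) = - U (Suc k) (x, t)" if "t \<in> I" for x t
  proof -
    have "((\<lambda>y. G k (y, t)) has_vector_derivative D 1 (x, t)) (at x)"
      by (rule partial_deriv_curve[where J = UNIV, OF D_x _ _ space_line]) (use that in auto)
    moreover have "((\<lambda>y. G k (y, t)) has_vector_derivative - U (Suc k) (x, t)) (at x)"
      by (rule partial_deriv_curve[where J = UNIV, OF G_space _ _ space_line]) (use that N in auto)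
    ultimately show ?thesis by (rule vector_derivative_unique_at)
  qed
  have "continuous_on ?S (D (1 + 2 * q))"
    using D_derivs[THEN conjunct2, THEN conjunct1, rule_format, of "1 + 2 * q"] N
    by (intro is_Ck_continuous[of "N - k - (1 + 2 * q)"]) simp
  then obtain B where B: "\<And>p. p \<in> thicken K \<Longrightarrow> norm (D (1 + 2 * q) p) \<le> B"
    using continuous_on_compact_bounded[OF _ compact_thicken[OF K(1)] thicken_subset[OF K(2)]] by blast
  show thesis
  proof (rule that[of "fd_weight_norm 1 q (1 + 2 * q) * B"])
    fix h x t :: real
    assume h: "0 < h" "of_int (fd_radius 1 q) * h \<le> 1" and xt: "(x, t) \<in> K"
    have t: "t \<in> I" using xt K(2) by auto
    have "norm (central_diff h 1 q (grid_fun 0 h (\<lambda>s. D 0 (x + s, t))) - D 1 (x + 0, t))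
        \<le> fd_weight_norm 1 q (1 + 2 * q) * B * h ^ (2 * q)"
      by (rule central_diff_consistent[where W = "\<lambda>j s. D j (x + s, t)" and r = 1])
        (use q h N in \<open>auto intro!: D t B[unfolded plus_1_eq_Suc] thickenI xt\<close>)
    then show "norm (central_diff h 1 q (grid_fun 0 h (\<lambda>s. G k (x + s, t))) + U (Suc k) (x, t))
        \<le> fd_weight_norm 1 q (1 + 2 * q) * B * h ^ (2 * q)"
      using D_1[OF t] D_derivs by simp
  qed
qed

text \<open>
  The model is split into \<open>G k\<close>, on which the space difference is consistent, and an error whose
  \<open>x\<close>-derivative is \<open>O(h ^ (2 q))\<close>.
\<close>

lemma model_step_consistent:
  assumes kq: "1 \<le> k" "1 \<le> q" and N: "2 * k + 2 * q + 2 < N" and \<tau>: "0 < \<tau>"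
    and K: "compact K" "K \<subseteq> UNIV \<times> I"
  obtains C where "\<forall>\<^sub>F h in at_right 0. \<forall>x t. (x, t) \<in> K \<longrightarrow>
    norm (central_diff h 1 q (\<lambda>j. model_time_diff k q (\<tau> * h) (x + of_int j * h, t)) + U (Suc k) (x, t))
      \<le> C * h ^ (2 * q)"
proof -
  obtain C1 where C1: "\<And>\<delta> x t. 0 < \<delta> \<Longrightarrow> of_int (fd_radius k q) * \<delta> \<le> 1 \<Longrightarrow> (x, t) \<in> thicken K \<Longrightarrow>
    \<exists>d. ((\<lambda>y. model_time_diff k q \<delta> (y, t)) has_vector_derivative d) (at x) \<and>
      norm (d + U (Suc k) (x, t)) \<le> C1 * \<delta> ^ (2 * q)"
    using model_time_diff_consistent[OF kq N compact_thicken[OF K(1)] thicken_subset[OF K(2)]] by blast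
  have "k + 2 * q + 2 < N" using N by simp
  then obtain C2 where C2: "\<And>h x t. 0 < h \<Longrightarrow> of_int (fd_radius 1 q) * h \<le> 1 \<Longrightarrow> (x, t) \<in> K \<Longrightarrow>
    norm (central_diff h 1 q (grid_fun 0 h (\<lambda>s. G k (x + s, t))) + U (Suc k) (x, t)) \<le> C2 * h ^ (2 * q)"
    using flux_space_diff_consistent[OF kq(2) _ K] by blast
  let ?C = "fd_weight_norm 1 q 1 * C1 * \<tau> ^ (2 * q) + C2"
  have "\<forall>\<^sub>F h in at_right 0. \<forall>x t. (x, t) \<in> K \<longrightarrow>
    norm (central_diff h 1 q (\<lambda>j. model_time_diff k q (\<tau> * h) (x + of_int j * h, t)) + U (Suc k) (x, t))
      \<le> ?C * h ^ (2 * q)"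
    using eventually_small[of "of_int (fd_radius 1 q)"] eventually_small[of "of_int (fd_radius k q) * \<tau>"]
  proof eventually_elim
    case (elim h)
    have h: "0 < h" "of_int (fd_radius 1 q) * h \<le> 1"
      "0 < \<tau> * h" "of_int (fd_radius k q) * (\<tau> * h) \<le> 1"
      using elim \<tau> by (simp_all add: mult.assoc)
    show ?case
    proof (intro allI impI)
      fix x t assume xt: "(x, t) \<in> K"
      have t: "t \<in> I" using xt K(2) by auto
      let ?m = "\<lambda>s. model_time_diff k q (\<tau> * h) (x + s, t)" and ?g = "\<lambda>s. G k (x + s, t)"
      have "\<exists>d. \<bar>s\<bar> \<le> 1 \<longrightarrow>
        ((\<lambda>s. ?m s - ?g s) has_vector_derivative d) (at s) \<and> norm d \<le> C1 * (\<tau> * h) ^ (2 * q)" for s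
      proof (cases "\<bar>s\<bar> \<le> 1")
        case s: True
        from C1[OF h(3,4) thickenI[OF xt s]] obtain d where
          d: "((\<lambda>y. model_time_diff k q (\<tau> * h) (y, t)) has_vector_derivative d) (at (x + s))"
            "norm (d + U (Suc k) (x + s, t)) \<le> C1 * (\<tau> * h) ^ (2 * q)" by blast
        have "((\<lambda>y. G k (y, t)) has_vector_derivative - U (Suc k) (x + s, t)) (at (x + s))"
          by (rule partial_deriv_curve[where J = UNIV, OF G_space _ _ space_line]) (use t N in auto)
        from has_vector_derivative_diff[OF d(1) this]
        have "((\<lambda>y. model_time_diff k q (\<tau> * h) (y, t) - G k (y, t)) has_vector_derivative
          d + U (Suc k) (x + s, t)) (at (x + s))" by simp
        from vector_diff_chain_at[OF has_vector_derivative_add[OF has_vector_derivative_const has_vector_derivative_id] this]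
        show ?thesis using d(2) by (intro exI[of _ "d + U (Suc k) (x + s, t)"]) (simp add: o_def)
      qed simp
      then have "\<exists>d. \<forall>s. \<bar>s\<bar> \<le> 1 \<longrightarrow>
        ((\<lambda>s. ?m s - ?g s) has_vector_derivative d s) (at s) \<and> norm (d s) \<le> C1 * (\<tau> * h) ^ (2 * q)"
        by (intro choice allI)
      then obtain d where d: "\<And>s. \<bar>s\<bar> \<le> 1 \<Longrightarrow> ((\<lambda>s. ?m s - ?g s) has_vector_derivative d s) (at s)"
        "\<And>s. \<bar>s\<bar> \<le> 1 \<Longrightarrow> norm (d s) \<le> C1 * (\<tau> * h) ^ (2 * q)" by auto
      have 1: "norm (central_diff h 1 q (grid_fun 0 h (\<lambda>s. ?m s - ?g s)))
          \<le> fd_weight_norm 1 q 1 * (C1 * (\<tau> * h) ^ (2 * q))"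
        by (rule central_diff_bound_derivative[OF kq(2) h(1,2) d])
      have "central_diff h 1 q (\<lambda>j. model_time_diff k q (\<tau> * h) (x + of_int j * h, t)) =
          central_diff h 1 q (grid_fun 0 h (\<lambda>s. ?m s - ?g s)) + central_diff h 1 q (grid_fun 0 h ?g)"
        by (simp add: grid_fun_def[abs_def] central_diff_diff)
      then have "norm (central_diff h 1 q (\<lambda>j. model_time_diff k q (\<tau> * h) (x + of_int j * h, t)) + U (Suc k) (x, t))
        \<le> norm (central_diff h 1 q (grid_fun 0 h (\<lambda>s. ?m s - ?g s))) +
          norm (central_diff h 1 q (grid_fun 0 h ?g) + U (Suc k) (x, t))"
        by (metis (no_types, lifting) add.assoc norm_triangle_ineq)
      also have "\<dots> \<le> fd_weight_norm 1 q 1 * (C1 * (\<tau> * h) ^ (2 * q)) + C2 * h ^ (2 * q)"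
        using 1 C2[OF h(1,2) xt] by (rule add_mono)
      also have "\<dots> = ?C * h ^ (2 * q)"
        by (simp add: power_mult_distrib algebra_simps)
      finally show "norm (central_diff h 1 q (\<lambda>j. model_time_diff k q (\<tau> * h) (x + of_int j * h, t)) + U (Suc k) (x, t))
        \<le> ?C * h ^ (2 * q)" .
    qed
  qed
  then show thesis by (rule that)
qed

text \<open>
  At \<open>\<bar>\<rho>\<bar> = O(h)\<close> the perturbation of size \<open>h ^ (Suc R - l)\<close> of the coefficient \<open>l\<close> contributes
  \<open>O(h ^ Suc R)\<close> whatever \<open>l\<close> is, so the loss is the factor \<open>\<delta> ^ k\<close> of the operator alone.
\<close>

lemma time_diff_stable:
  assumes k: "k \<le> R" "k < N" and \<tau>: "0 < \<tau>" and D: "0 \<le> D"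
    and K: "compact K" "K \<subseteq> UNIV \<times> I"
  obtains C where "0 \<le> C" "\<forall>\<^sub>F h in at_right 0. \<forall>p\<in>K. \<forall>c.
    (\<forall>l\<le>k. norm (c l - U l p) \<le> D * h ^ (Suc R - l)) \<longrightarrow>
    norm (central_diff (\<tau> * h) k q (grid_fun 0 (\<tau> * h) (\<lambda>\<rho>. f (taylor_poly k c \<rho>)))
      - model_time_diff k q (\<tau> * h) p) \<le> C * h ^ (Suc R - k)"
proof -
  let ?P = "\<lambda>z. taylor_poly k (\<lambda>l. U l (fst z)) (snd z)"
  have "continuous_on ((UNIV \<times> I) \<times> UNIV) ?P"
    unfolding taylor_poly_def
  proof (intro continuous_on_sum continuous_on_scaleR)
    show "continuous_on ((UNIV \<times> I) \<times> UNIV) (\<lambda>z :: (real \<times> real) \<times> real. U l (fst z))"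
      if "l \<in> {0..k}" for l
      by (rule continuous_on_compose2[OF is_Ck_continuous[OF U_Ck]])
        (use that k in \<open>auto intro!: continuous_intros\<close>)
  qed (auto intro!: continuous_intros)
  moreover have "K \<times> {-1..1 :: real} \<subseteq> (UNIV \<times> I) \<times> UNIV" using K(2) by auto
  ultimately obtain A where A: "\<And>z. z \<in> K \<times> {-1..1} \<Longrightarrow> norm (?P z) \<le> A"
    by (rule continuous_on_compact_bounded[OF _ compact_Times[OF K(1) compact_Icc]]) blast
  let ?s = "of_int (fd_radius k q) :: real"
  have s: "0 \<le> ?s" by (simp add: fd_radius_def)
  define B where "B = (\<Sum>l = 0..k. (?s * \<tau>) ^ l / fact l * D)"
  have B: "0 \<le> B"
    unfolding B_def using D \<tau> s by (intro sum_nonneg mult_nonneg_nonneg divide_nonneg_nonneg) auto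
  have "is_Ck (Suc 0) UNIV f"
    using is_Ck_mono[OF f] k by simp
  \<comment> \<open>\<open>A\<close> bounds the exact polynomials and \<open>B\<close> the perturbation, so both arguments of \<open>f\<close> stay in
  one fixed ball.\<close>
  then obtain L where L: "0 \<le> L"
    "\<And>a b. norm a \<le> A + B \<Longrightarrow> norm b \<le> A + B \<Longrightarrow> norm (f a - f b) \<le> L * norm (a - b)"
    by (rule is_Ck_Lipschitz_on_cball) blast
  let ?C = "fd_weight_norm k q 0 * (L * B) / \<tau> ^ k"
  have "\<forall>\<^sub>F h in at_right 0. \<forall>p\<in>K. \<forall>c.
    (\<forall>l\<le>k. norm (c l - U l p) \<le> D * h ^ (Suc R - l)) \<longrightarrow>
    norm (central_diff (\<tau> * h) k q (grid_fun 0 (\<tau> * h) (\<lambda>\<rho>. f (taylor_poly k c \<rho>)))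
      - model_time_diff k q (\<tau> * h) p) \<le> ?C * h ^ (Suc R - k)"
    using eventually_small[of "?s * \<tau>"]
  proof eventually_elim
    case (elim h)
    then have h: "0 < h" "h < 1" "?s * \<tau> * h \<le> 1" by auto
    show ?case
    proof (intro ballI allI impI)
      fix p c assume p: "p \<in> K" and c: "\<forall>l\<le>k. norm (c l - U l p) \<le> D * h ^ (Suc R - l)"
      have pert: "norm (f (taylor_poly k c \<rho>) - f (taylor_poly k (\<lambda>l. U l p) \<rho>)) \<le> L * (B * h ^ Suc R)"
        if \<rho>: "\<bar>\<rho>\<bar> \<le> ?s * \<tau> * h" for \<rho>
      proof -
        have "norm (taylor_poly k c \<rho> - taylor_poly k (\<lambda>l. U l p) \<rho>)
            = norm (\<Sum>l = 0..k. (\<rho> ^ l / fact l) *\<^sub>R (c l - U l p))"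
          by (simp add: taylor_poly_def scaleR_diff_right sum_subtractf)
        also have "\<dots> \<le> (\<Sum>l = 0..k. (?s * \<tau>) ^ l / fact l * D * h ^ Suc R)"
        proof (rule sum_norm_le)
          fix l assume l: "l \<in> {0..k}"
          have pow: "\<bar>\<rho> ^ l\<bar> \<le> (?s * \<tau> * h) ^ l"
            unfolding power_abs using \<rho> by (intro power_mono) auto
          have "norm ((\<rho> ^ l / fact l) *\<^sub>R (c l - U l p)) \<le> ((?s * \<tau> * h) ^ l / fact l) * (D * h ^ (Suc R - l))"
            using c l pow by (auto intro!: mult_mono divide_right_mono)
          also have "\<dots> = (?s * \<tau>) ^ l / fact l * D * (h ^ l * h ^ (Suc R - l))"
            by (simp add: power_mult_distrib)
          also have "h ^ l * h ^ (Suc R - l) = h ^ Suc R"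
            using l k by (simp flip: power_add)
          finally show "norm ((\<rho> ^ l / fact l) *\<^sub>R (c l - U l p)) \<le> (?s * \<tau>) ^ l / fact l * D * h ^ Suc R" .
        qed
        also have "\<dots> = B * h ^ Suc R" unfolding B_def sum_distrib_right ..
        finally have close: "norm (taylor_poly k c \<rho> - taylor_poly k (\<lambda>l. U l p) \<rho>) \<le> B * h ^ Suc R" .
        also have "\<dots> \<le> B * 1"
          using B h by (intro mult_left_mono power_le_one) auto
        finally have "norm (taylor_poly k c \<rho> - taylor_poly k (\<lambda>l. U l p) \<rho>) \<le> B" by simp
        moreover have "norm (taylor_poly k (\<lambda>l. U l p) \<rho>) \<le> A"
          using A[of "(p, \<rho>)"] p order_trans[OF \<rho> h(3)] by (simp add: abs_le_iff)
        ultimately have "norm (taylor_poly k (\<lambda>l. U l p) \<rho>) \<le> A + B" "norm (taylor_poly k c \<rho>) \<le> A + B"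
          using B norm_triangle_sub[of "taylor_poly k c \<rho>" "taylor_poly k (\<lambda>l. U l p) \<rho>"] by linarith+
        then have "norm (f (taylor_poly k c \<rho>) - f (taylor_poly k (\<lambda>l. U l p) \<rho>))
            \<le> L * norm (taylor_poly k c \<rho> - taylor_poly k (\<lambda>l. U l p) \<rho>)"
          by (intro L(2))
        also have "\<dots> \<le> L * (B * h ^ Suc R)" using close L(1) by (rule mult_left_mono)
        finally show ?thesis .
      qed
      have "norm (central_diff (\<tau> * h) k q (grid_fun 0 (\<tau> * h) (\<lambda>\<rho>. f (taylor_poly k c \<rho>)))
          - model_time_diff k q (\<tau> * h) p) \<le> fd_weight_norm k q 0 * (L * (B * h ^ Suc R)) / (\<tau> * h) ^ k"
        unfolding model_time_diff_def central_diff_diff[symmetric]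
      proof (rule central_diff_bound)
        fix l assume l: "\<bar>l\<bar> \<le> fd_radius k q"
        have "\<bar>of_int l * (\<tau> * h)\<bar> = of_int \<bar>l\<bar> * (\<tau> * h)"
          using \<tau> h by (simp add: abs_mult)
        also have "\<dots> \<le> ?s * (\<tau> * h)"
          using l \<tau> h by (intro mult_right_mono) auto
        finally show "norm (grid_fun 0 (\<tau> * h) (\<lambda>\<rho>. f (taylor_poly k c \<rho>)) l -
            grid_fun 0 (\<tau> * h) (\<lambda>\<rho>. f (taylor_poly k (\<lambda>l. U l p) \<rho>)) l)
            \<le> L * (B * h ^ Suc R) * \<bar>of_int l\<bar> ^ 0"
          using pert[of "of_int l * (\<tau> * h)"] by (simp add: grid_fun_def mult.assoc)
      qed (use \<tau> h in simp)
      also have "h ^ Suc R = h ^ k * h ^ (Suc R - k)"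
        using k by (simp flip: power_add)
      also have "fd_weight_norm k q 0 * (L * (B * (h ^ k * h ^ (Suc R - k)))) / (\<tau> * h) ^ k = ?C * h ^ (Suc R - k)"
        using h by (simp add: power_mult_distrib)
      finally show "norm (central_diff (\<tau> * h) k q (grid_fun 0 (\<tau> * h) (\<lambda>\<rho>. f (taylor_poly k c \<rho>)))
          - model_time_diff k q (\<tau> * h) p) \<le> ?C * h ^ (Suc R - k)" .
    qed
  qed
  moreover have "0 \<le> ?C"
    using L(1) B \<tau> fd_weight_norm_nonneg[of k q 0] by simp
  ultimately show thesis by (rule that[rotated])
qed

end

section \<open>Propagation of errors and the local truncation error\<close>

lemma norm_minus_diff: "norm (- v - w) = norm (v + w)" for v w :: "'b::real_normed_vector"
  using norm_minus_cancel[of "v + w"] by (simp add: algebra_simps)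

lemma half_order_bounds:
  assumes "k < R"
  shows "1 \<le> half_order R k" "R - k \<le> 2 * half_order R k" "2 * half_order R k \<le> R - k + 1"
proof -
  define c where "c = \<lceil>(real R - real k) / 2\<rceil>"
  have "of_int c - 1 < (real R - real k) / 2 \<and> (real R - real k) / 2 \<le> of_int c"
    unfolding c_def by (rule ceiling_correct)
  then have "real_of_int (int R - int k) \<le> of_int (2 * c)" "real_of_int (2 * c) < of_int (int R - int k + 2)"
    by auto
  then have "int R - int k \<le> 2 * c" "2 * c < int R - int k + 2"
    unfolding of_int_le_iff of_int_less_iff .
  then show "1 \<le> half_order R k" "R - k \<le> 2 * half_order R k" "2 * half_order R k \<le> R - k + 1"
    using assms unfolding half_order_def c_def[symmetric] by linarith+
qed

lemma weno_radius_bound: "R \<le> 2 * weno_radius R - 1"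
proof -
  have "(real R + 1) / 2 \<le> weno_radius R"
    unfolding weno_radius_def by (rule real_nat_ceiling_ge)
  then have "real (R + 1) \<le> real (2 * weno_radius R)" by simp
  then have "R + 1 \<le> 2 * weno_radius R" unfolding of_nat_le_iff .
  then show ?thesis by simp
qed

context solution_jet
begin

text \<open>
  The time interval has no last element, so the times occurring in \<open>K\<close> can be extended to the right
  within \<open>I\<close>; for small \<open>h\<close> the whole time step takes place in this larger compact set.
\<close>

lemma taylor_remainder_uniform:
  assumes n: "n < N" and \<tau>: "0 < \<tau>" and K: "compact K" "K \<subseteq> UNIV \<times> I"
  obtains C where "\<forall>\<^sub>F h in at_right 0. \<forall>x t. (x, t) \<in> K \<longrightarrow>
    norm (U 0 (x, t + \<tau> * h) - taylor_poly n (\<lambda>l. U l (x, t)) (\<tau> * h)) \<le> C * h ^ Suc n"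
proof (cases "K = {}")
  case True
  then show ?thesis using that by auto
next
  case False
  have "compact (snd ` K)" "snd ` K \<noteq> {}"
    using K(1) False by (auto intro!: compact_continuous_image continuous_intros)
  then obtain t0 t1 where t0: "t0 \<in> snd ` K" "\<And>t. t \<in> snd ` K \<Longrightarrow> t0 \<le> t"
    and t1: "t1 \<in> snd ` K" "\<And>t. t \<in> snd ` K \<Longrightarrow> t \<le> t1"
    by (metis compact_attains_inf compact_attains_sup)
  have in_I: "t0 \<in> I" "t1 \<in> I" using t0(1) t1(1) K(2) by auto
  from I in_I obtain t2 where t2: "t2 \<in> I" "t1 < t2" unfolding time_interval_def by blast
  have seg: "{t0..t2} \<subseteq> I" using time_interval_segment[OF I in_I(1) t2(1)] .
  have "compact (fst ` K \<times> {t0..t2})"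
    using K(1) by (intro compact_Times compact_Icc compact_continuous_image continuous_intros)
  moreover have "fst ` K \<times> {t0..t2} \<subseteq> UNIV \<times> I" using seg by auto
  moreover have "continuous_on (UNIV \<times> I) (U (Suc n))"
    using U_Ck[of "Suc n"] n is_Ck_continuous by auto
  ultimately obtain B where B: "\<And>p. p \<in> fst ` K \<times> {t0..t2} \<Longrightarrow> norm (U (Suc n) p) \<le> B"
    using continuous_on_compact_bounded by blast
  have "\<forall>\<^sub>F h in at_right 0. \<forall>x t. (x, t) \<in> K \<longrightarrow>
    norm (U 0 (x, t + \<tau> * h) - taylor_poly n (\<lambda>l. U l (x, t)) (\<tau> * h)) \<le> (B * \<tau> ^ Suc n) * h ^ Suc n"
    using eventually_small[of "\<tau> / (t2 - t1)"]
  proof eventually_elim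
    case (elim h)
    then have h: "0 < \<tau> * h" "\<tau> * h \<le> t2 - t1"
      using \<tau> t2(2) by (auto simp: field_simps)
    show ?case
    proof (intro allI impI)
      fix x t assume xt: "(x, t) \<in> K"
      have t: "t0 \<le> t" "t \<le> t1" using xt t0(2)[of t] t1(2)[of t] by force+
      have "norm (U 0 (x, t + \<tau> * h) - (\<Sum>j<Suc n. ((t + \<tau> * h - t) ^ j / fact j) *\<^sub>R U j (x, t)))
          \<le> B * \<bar>t + \<tau> * h - t\<bar> ^ Suc n"
      proof (rule taylor_bound[where W = "\<lambda>l s. U l (x, s)" and J = "{t0..t2}"])
        show "((\<lambda>s. U j (x, s)) has_vector_derivative U (Suc j) (x, r)) (at r within {t0..t2})"
          if "j < Suc n" "r \<in> {t0..t2}" for j r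
          by (rule partial_deriv_curve[OF U_time _ _ time_line]) (use that n seg in auto)
        show "norm (U (Suc n) (x, r)) \<le> B" if "r \<in> closed_segment t (t + \<tau> * h)" for r
          using that h t xt by (intro B) (force simp: closed_segment_eq_real_ivl)
      qed (use t h in auto)
      then show "norm (U 0 (x, t + \<tau> * h) - taylor_poly n (\<lambda>l. U l (x, t)) (\<tau> * h)) \<le> (B * \<tau> ^ Suc n) * h ^ Suc n"
        using h by (simp add: taylor_poly_def atLeast0AtMost lessThan_Suc_atMost power_mult_distrib mult_ac)
    qed
  qed
  then show ?thesis by (rule that)
qed

text \<open>
  The data enter through the exact values \<open>U 0\<close>, and the flux through its order on them, where
  \<open>- U 1\<close> stands for the \<open>x\<close>-derivative of the flux. The compact set is generalised in the induction, as
  the neighbours used in a step lie in \<open>thicken K\<close>. The bound on \<open>N\<close> collects the derivatives used for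
  \<open>k < R\<close>, for which \<open>k + 2 q \<le> R + 1\<close>.
\<close>

lemma approx_deriv_error:
  fixes F :: "'b list \<Rightarrow> 'b"
  assumes N: "2 * R + 4 < N" and \<tau>: "0 < \<tau>"
    and flux: "uniformly_bigo I (\<lambda>h a i t. flux_diff (weno_radius R) F h (grid_fun a h (\<lambda>x. U 0 (x, t))) i
      + U 1 (a + of_int i * h, t)) (2 * weno_radius R - 1)"
    and l: "l \<le> R" and K: "compact K" "K \<subseteq> UNIV \<times> I"
  shows "\<exists>C. \<forall>\<^sub>F h in at_right 0. \<forall>a i t. (a + of_int i * h, t) \<in> K \<longrightarrow>
    norm (approx_deriv R f F h (\<tau> * h) (grid_fun a h (\<lambda>x. U 0 (x, t))) l i - U l (a + of_int i * h, t))
      \<le> C * h ^ (Suc R - l)"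
  using l K
proof (induction l arbitrary: K rule: less_induct)
  case (less l)
  let ?u = "\<lambda>h a t. approx_deriv R f F h (\<tau> * h) (grid_fun a h (\<lambda>x. U 0 (x, t)))"
  consider "l = 0" | "l = 1" | k where "l = Suc k" "1 \<le> k"
    by (cases l) (auto simp: Suc_le_eq)
  then show ?case
  proof cases
    case 1
    then show ?thesis by (intro exI[of _ 0]) (simp add: grid_fun_def)
  next
    case 2
    from flux less.prems obtain C where C: "\<forall>\<^sub>F h in at_right 0. \<forall>a i t. (a + of_int i * h, t) \<in> K \<longrightarrow>
      norm (flux_diff (weno_radius R) F h (grid_fun a h (\<lambda>x. U 0 (x, t))) i + U 1 (a + of_int i * h, t))
        \<le> C * h ^ (2 * weno_radius R - 1)"
      unfolding uniformly_bigo_def by blast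
    have "\<forall>\<^sub>F h in at_right 0. \<forall>a i t. (a + of_int i * h, t) \<in> K \<longrightarrow>
      norm (?u h a t l i - U l (a + of_int i * h, t)) \<le> \<bar>C\<bar> * h ^ (Suc R - l)"
      using C eventually_small[of 0]
    proof eventually_elim
      case (elim h)
      \<comment> \<open>The flux may be one order better than the bound needs, since \<open>2 r - 1 \<ge> R\<close>.\<close>
      have "C * h ^ (2 * weno_radius R - 1) \<le> \<bar>C\<bar> * h ^ R"
        using elim(2) weno_radius_bound[of R] by (intro mult_mono power_decreasing) auto
      then show ?case using elim(1) 2 by (fastforce simp: norm_minus_diff intro: order_trans)
    qed
    then show ?thesis ..
  next
    case (3 k)
    have kR: "k < R" using less.prems 3 by simp
    define q where "q = half_order R k"
    have q: "1 \<le> q" "R - k \<le> 2 * q" "2 * q \<le> R - k + 1"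
      using half_order_bounds[OF kR] by (auto simp: q_def)
    have Nq: "2 * k + 2 * q + 2 < N" using N kR q(3) by linarith
    have K': "compact (thicken K)" "thicken K \<subseteq> UNIV \<times> I"
      using less.prems by (auto intro!: compact_thicken thicken_subset)
    have "\<forall>j\<in>{..k}. \<exists>C. \<forall>\<^sub>F h in at_right 0. \<forall>a i t. (a + of_int i * h, t) \<in> thicken K \<longrightarrow>
      norm (?u h a t j i - U j (a + of_int i * h, t)) \<le> C * h ^ (Suc R - j)"
      using less.IH[OF _ _ K'] 3 kR by simp
    then obtain C where C: "\<forall>j\<in>{..k}. \<forall>\<^sub>F h in at_right 0. \<forall>a i t. (a + of_int i * h, t) \<in> thicken K \<longrightarrow>
      norm (?u h a t j i - U j (a + of_int i * h, t)) \<le> C j * h ^ (Suc R - j)"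
      by (rule bchoice[THEN exE])
    define D where "D = (\<Sum>j\<le>k. \<bar>C j\<bar>)"
    have D: "0 \<le> D" unfolding D_def by (intro sum_nonneg) auto
    have CD: "C j \<le> D" if "j \<le> k" for j
      using member_le_sum[of j "{..k}" "\<lambda>j. \<bar>C j\<bar>"] that
      unfolding D_def by (auto intro: order_trans[OF abs_ge_self])
    have kN: "k \<le> R" "k < N" using kR N by auto
    obtain C1 where C1: "0 \<le> C1" "\<forall>\<^sub>F h in at_right 0. \<forall>p\<in>thicken K. \<forall>c.
      (\<forall>l\<le>k. norm (c l - U l p) \<le> D * h ^ (Suc R - l)) \<longrightarrow>
      norm (central_diff (\<tau> * h) k q (grid_fun 0 (\<tau> * h) (\<lambda>\<rho>. f (taylor_poly k c \<rho>)))
        - model_time_diff k q (\<tau> * h) p) \<le> C1 * h ^ (Suc R - k)"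
      using time_diff_stable[OF kN \<tau> D K', of q] by blast
    obtain C2 where C2: "\<forall>\<^sub>F h in at_right 0. \<forall>x t. (x, t) \<in> K \<longrightarrow>
      norm (central_diff h 1 q (\<lambda>j. model_time_diff k q (\<tau> * h) (x + of_int j * h, t)) + U (Suc k) (x, t))
        \<le> C2 * h ^ (2 * q)"
      using model_step_consistent[OF 3(2) q(1) Nq \<tau> less.prems(2,3)] by blast
    let ?C = "fd_weight_norm 1 q 0 * C1 + \<bar>C2\<bar>"
    have "\<forall>\<^sub>F h in at_right 0. \<forall>j\<in>{..k}. \<forall>a i t. (a + of_int i * h, t) \<in> thicken K \<longrightarrow>
      norm (?u h a t j i - U j (a + of_int i * h, t)) \<le> C j * h ^ (Suc R - j)"
      using C by (subst eventually_ball_finite_distrib) auto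
    then have "\<forall>\<^sub>F h in at_right 0. \<forall>a i t. (a + of_int i * h, t) \<in> K \<longrightarrow>
      norm (?u h a t l i - U l (a + of_int i * h, t)) \<le> ?C * h ^ (Suc R - l)"
      using C1(2) C2 eventually_small[of "of_int (fd_radius 1 q)"]
    proof eventually_elim
      case (elim h)
      then have h: "0 < h" "h < 1" "of_int (fd_radius 1 q) * h \<le> 1" by auto
      show ?case
      proof (intro allI impI)
        fix a i t assume xt: "(a + of_int i * h, t) \<in> K"
        let ?x = "a + of_int i * h"
        define f' where "f' j = central_diff (\<tau> * h) k q
          (grid_fun 0 (\<tau> * h) (\<lambda>\<rho>. f (taylor_poly k (\<lambda>l. ?u h a t l (i + j)) \<rho>)))" for j
        define m where "m j = model_time_diff k q (\<tau> * h) (?x + of_int j * h, t)" for j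
        have close: "norm (f' j - m j) \<le> C1 * h ^ (Suc R - k)" if j: "\<bar>j\<bar> \<le> fd_radius 1 q" for j
        proof -
          have "\<bar>of_int j * h\<bar> \<le> of_int (fd_radius 1 q) * h"
            using j h(1) by (simp add: abs_mult flip: of_int_abs)
          then have mem: "(?x + of_int j * h, t) \<in> thicken K"
            using h(3) by (intro thickenI[OF xt]) linarith
          have x: "a + of_int (i + j) * h = ?x + of_int j * h"
            by (simp add: algebra_simps)
          have pt: "(a + of_int (i + j) * h, t) \<in> thicken K"
            unfolding x by (rule mem)
          have "norm (?u h a t l (i + j) - U l (?x + of_int j * h, t)) \<le> D * h ^ (Suc R - l)"
            if "l \<le> k" for l
          proof -
            have "norm (?u h a t l (i + j) - U l (a + of_int (i + j) * h, t)) \<le> C l * h ^ (Suc R - l)"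
              using elim(1)[THEN bspec, of l] that pt by blast
            also have "\<dots> \<le> D * h ^ (Suc R - l)"
              using CD[OF that] h(1) by (intro mult_right_mono) auto
            finally show ?thesis unfolding x .
          qed
          then show ?thesis
            using elim(2)[THEN bspec, OF mem, THEN spec, of "\<lambda>l. ?u h a t l (i + j)"]
            unfolding f'_def m_def by simp
        qed
        have "norm (central_diff h 1 q (\<lambda>j. f' j - m j)) \<le> fd_weight_norm 1 q 0 * (C1 * h ^ (Suc R - k)) / h ^ 1"
          using close by (intro central_diff_bound h(1)) simp
        also have "h ^ (Suc R - k) = h * h ^ (Suc R - l)"
          using 3 kR by (simp flip: power_Suc add: Suc_diff_le)
        also have "fd_weight_norm 1 q 0 * (C1 * (h * h ^ (Suc R - l))) / h ^ 1 = fd_weight_norm 1 q 0 * C1 * h ^ (Suc R - l)"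
          using h(1) by simp
        finally have 1: "norm (central_diff h 1 q f' - central_diff h 1 q m) \<le> fd_weight_norm 1 q 0 * C1 * h ^ (Suc R - l)"
          by (simp add: central_diff_diff)
        have "norm (central_diff h 1 q m + U l (?x, t)) \<le> C2 * h ^ (2 * q)"
          using elim(3) xt 3(1) unfolding m_def by blast
        also have "\<dots> \<le> \<bar>C2\<bar> * h ^ (Suc R - l)"
          using h q(2) 3 by (intro mult_mono power_decreasing) auto
        finally have 2: "norm (central_diff h 1 q m + U l (?x, t)) \<le> \<bar>C2\<bar> * h ^ (Suc R - l)" .
        have "?u h a t l i = - central_diff h 1 q f'"
          using 3 unfolding f'_def q_def by simp
        then have "norm (?u h a t l i - U l (?x, t)) =
            norm ((central_diff h 1 q f' - central_diff h 1 q m) + (central_diff h 1 q m + U l (?x, t)))"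
          by (simp add: norm_minus_diff)
        also have "\<dots> \<le> fd_weight_norm 1 q 0 * C1 * h ^ (Suc R - l) + \<bar>C2\<bar> * h ^ (Suc R - l)"
          using 1 2 by (rule norm_triangle_mono)
        finally show "norm (?u h a t l i - U l (?x, t)) \<le> ?C * h ^ (Suc R - l)"
          by (simp add: algebra_simps)
      qed
    qed
    then show ?thesis by (rule exI[of _ ?C])
  qed
qed

lemma local_truncation_error:
  fixes F :: "'b list \<Rightarrow> 'b"
  assumes N: "2 * R + 4 < N" and \<tau>: "0 < \<tau>"
    and flux: "uniformly_bigo I (\<lambda>h a i t. flux_diff (weno_radius R) F h (grid_fun a h (\<lambda>x. U 0 (x, t))) i
      + U 1 (a + of_int i * h, t)) (2 * weno_radius R - 1)"
  shows "uniformly_bigo I (\<lambda>h a i t. U 0 (a + of_int i * h, t + \<tau> * h)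
      - (\<Sum>l = 0..R. ((\<tau> * h) ^ l / fact l) *\<^sub>R
          approx_deriv R f F h (\<tau> * h) (grid_fun a h (\<lambda>x. U 0 (x, t))) l i)) (R + 1)"
  unfolding uniformly_bigo_def
proof (intro allI impI)
  fix K :: "(real \<times> real) set" assume K: "compact K \<and> K \<subseteq> UNIV \<times> I"
  let ?u = "\<lambda>h a t. approx_deriv R f F h (\<tau> * h) (grid_fun a h (\<lambda>x. U 0 (x, t)))"
  have "R < N" using N by simp
  then obtain C0 where C0: "\<forall>\<^sub>F h in at_right 0. \<forall>x t. (x, t) \<in> K \<longrightarrow>
    norm (U 0 (x, t + \<tau> * h) - taylor_poly R (\<lambda>l. U l (x, t)) (\<tau> * h)) \<le> C0 * h ^ Suc R"
    using taylor_remainder_uniform[OF _ \<tau>, of R K] K by blast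
  have "\<forall>l\<in>{..R}. \<exists>C. \<forall>\<^sub>F h in at_right 0. \<forall>a i t. (a + of_int i * h, t) \<in> K \<longrightarrow>
    norm (?u h a t l i - U l (a + of_int i * h, t)) \<le> C * h ^ (Suc R - l)"
    using approx_deriv_error[OF N \<tau> flux] K by simp
  then obtain C where C: "\<forall>l\<in>{..R}. \<forall>\<^sub>F h in at_right 0. \<forall>a i t. (a + of_int i * h, t) \<in> K \<longrightarrow>
    norm (?u h a t l i - U l (a + of_int i * h, t)) \<le> C l * h ^ (Suc R - l)"
    by (rule bchoice[THEN exE])
  let ?C = "C0 + (\<Sum>l = 0..R. \<tau> ^ l / fact l * C l)"
  have "\<forall>\<^sub>F h in at_right 0. \<forall>l\<in>{..R}. \<forall>a i t. (a + of_int i * h, t) \<in> K \<longrightarrow>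
    norm (?u h a t l i - U l (a + of_int i * h, t)) \<le> C l * h ^ (Suc R - l)"
    using C by (subst eventually_ball_finite_distrib) auto
  then have "\<forall>\<^sub>F h in at_right 0. \<forall>a i t. (a + of_int i * h, t) \<in> K \<longrightarrow>
    norm (U 0 (a + of_int i * h, t + \<tau> * h) - (\<Sum>l = 0..R. ((\<tau> * h) ^ l / fact l) *\<^sub>R ?u h a t l i))
      \<le> ?C * h ^ (R + 1)"
    using C0 eventually_small[of 0]
  proof eventually_elim
    case (elim h)
    show ?case
    proof (intro allI impI)
      fix a i t assume xt: "(a + of_int i * h, t) \<in> K"
      let ?x = "a + of_int i * h"
      let ?S = "\<Sum>l = 0..R. ((\<tau> * h) ^ l / fact l) *\<^sub>R ?u h a t l i"
      let ?T = "taylor_poly R (\<lambda>l. U l (?x, t)) (\<tau> * h)"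
      have "?S - ?T = (\<Sum>l = 0..R. ((\<tau> * h) ^ l / fact l) *\<^sub>R (?u h a t l i - U l (?x, t)))"
        by (simp add: taylor_poly_def scaleR_diff_right sum_subtractf)
      also have "norm \<dots> \<le> (\<Sum>l = 0..R. \<tau> ^ l / fact l * C l * h ^ Suc R)"
      proof (rule sum_norm_le)
        fix l assume l: "l \<in> {0..R}"
        have err: "norm (?u h a t l i - U l (?x, t)) \<le> C l * h ^ (Suc R - l)"
          using elim(1)[THEN bspec, of l] l xt by simp
        have "0 \<le> (\<tau> * h) ^ l / fact l" using \<tau> elim(3) by simp
        with err have "norm (((\<tau> * h) ^ l / fact l) *\<^sub>R (?u h a t l i - U l (?x, t)))
            \<le> (\<tau> * h) ^ l / fact l * (C l * h ^ (Suc R - l))"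
          unfolding norm_scaleR by (simp only: abs_of_nonneg mult_left_mono)
        also have "\<dots> = \<tau> ^ l / fact l * C l * (h ^ l * h ^ (Suc R - l))"
          by (simp add: power_mult_distrib)
        also have "h ^ l * h ^ (Suc R - l) = h ^ Suc R"
          using l by (simp flip: power_add)
        finally show "norm (((\<tau> * h) ^ l / fact l) *\<^sub>R (?u h a t l i - U l (?x, t)))
            \<le> \<tau> ^ l / fact l * C l * h ^ Suc R" .
      qed
      finally have "norm (?T - ?S) \<le> (\<Sum>l = 0..R. \<tau> ^ l / fact l * C l) * h ^ Suc R"
        by (simp add: norm_minus_commute sum_distrib_right)
      moreover have "norm (U 0 (?x, t + \<tau> * h) - ?T) \<le> C0 * h ^ Suc R"
        using elim(2) xt by blast
      ultimately have "norm ((U 0 (?x, t + \<tau> * h) - ?T) + (?T - ?S))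
          \<le> C0 * h ^ Suc R + (\<Sum>l = 0..R. \<tau> ^ l / fact l * C l) * h ^ Suc R"
        by (intro norm_triangle_mono)
      then show "norm (U 0 (?x, t + \<tau> * h) - ?S) \<le> ?C * h ^ (R + 1)"
        by (simp add: algebra_simps)
    qed
  qed
  then show "\<exists>C. \<forall>\<^sub>F h in at_right 0. \<forall>a i t. (a + of_int i * h, t) \<in> K \<longrightarrow>
    norm (U 0 (a + of_int i * h, t + \<tau> * h) - (\<Sum>l = 0..R. ((\<tau> * h) ^ l / fact l) *\<^sub>R ?u h a t l i))
      \<le> C * h ^ (R + 1)" by (rule exI[of _ ?C])
qed

end

theorem proposition1:
  fixes R M :: nat
  assumes "R \<ge> 1"
  shows "\<exists>N. \<forall>(f :: real^'m \<Rightarrow> real^'m) (F :: (real^'m) list \<Rightarrow> real^'m) (\<tau> :: real) I u.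
    Ck_on N UNIV f \<longrightarrow>
    flux_has_order M f (weno_radius R) F (2 * weno_radius R - 1) \<longrightarrow>
    0 < \<tau> \<longrightarrow>
    time_interval I \<longrightarrow>
    smooth_solution N f I u \<longrightarrow>
    uniformly_bigo I
      (\<lambda>h a i t. u (a + of_int i * h) (t + \<tau> * h)
        - (\<Sum>l = 0..R. ((\<tau> * h) ^ l / fact l) *\<^sub>R
            approx_deriv R f F h (\<tau> * h) (grid_fun a h (\<lambda>x. u x t)) l i))
      (R + 1)"
proof (intro exI[of _ "M + 2 * R + 5"] allI impI)
  \<comment> \<open>\<open>M\<close> derivatives let the order of the flux apply to \<open>u\<close>, and more than \<open>2 R + 4\<close> serve the expansions.\<close>
  let ?N = "M + 2 * R + 5"
  fix f :: "real^'m \<Rightarrow> real^'m" and F :: "(real^'m) list \<Rightarrow> real^'m" and \<tau> :: real and I u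
  assume f: "Ck_on ?N UNIV f" and F: "flux_has_order M f (weno_radius R) F (2 * weno_radius R - 1)"
    and \<tau>: "0 < \<tau>" and I: "time_interval I" and u: "smooth_solution ?N f I u"
  obtain U G where "solution_jet f I ?N U G" and U: "\<And>x t. U 0 (x, t) = u x t"
    using smooth_solution_jet[OF I f u] by auto
  then interpret solution_jet f I ?N U G by simp
  have "smooth_solution M f I u"
    using u Ck_on_mono[of ?N _ _ M] by (auto simp: smooth_solution_def)
  then have flux: "uniformly_bigo I (\<lambda>h a i t. flux_diff (weno_radius R) F h (grid_fun a h (\<lambda>x. u x t)) i
      - vector_derivative (\<lambda>x. f (u x t)) (at (a + of_int i * h))) (2 * weno_radius R - 1)"
    using F I unfolding flux_has_order_def by blast
  have fx: "vector_derivative (\<lambda>x. f (u x t)) (at x) = - U 1 (x, t)" if "t \<in> I" for x t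
  proof -
    have "((\<lambda>y. G 0 (y, t)) has_vector_derivative - U (Suc 0) (x, t)) (at x)"
      by (rule partial_deriv_curve[where J = UNIV, OF G_space _ _ space_line]) (use that in auto)
    then show ?thesis by (simp add: G_0 U vector_derivative_at)
  qed
  have "uniformly_bigo I (\<lambda>h a i t. flux_diff (weno_radius R) F h (grid_fun a h (\<lambda>x. U 0 (x, t))) i
      + U 1 (a + of_int i * h, t)) (2 * weno_radius R - 1)"
    unfolding uniformly_bigo_def
  proof (intro allI impI)
    fix K :: "(real \<times> real) set" assume K: "compact K \<and> K \<subseteq> UNIV \<times> I"
    with flux obtain C where C: "\<forall>\<^sub>F h in at_right 0. \<forall>a i t. (a + of_int i * h, t) \<in> K \<longrightarrow>
      norm (flux_diff (weno_radius R) F h (grid_fun a h (\<lambda>x. u x t)) i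
        - vector_derivative (\<lambda>x. f (u x t)) (at (a + of_int i * h))) \<le> C * h ^ (2 * weno_radius R - 1)"
      unfolding uniformly_bigo_def by blast
    have t: "t \<in> I" if "(x, t) \<in> K" for x t using K that by auto
    from C have "\<forall>\<^sub>F h in at_right 0. \<forall>a i t. (a + of_int i * h, t) \<in> K \<longrightarrow>
      norm (flux_diff (weno_radius R) F h (grid_fun a h (\<lambda>x. U 0 (x, t))) i
        + U 1 (a + of_int i * h, t)) \<le> C * h ^ (2 * weno_radius R - 1)"
      by eventually_elim (auto simp: U fx[OF t])
    then show "\<exists>C. \<forall>\<^sub>F h in at_right 0. \<forall>a i t. (a + of_int i * h, t) \<in> K \<longrightarrow>
      norm (flux_diff (weno_radius R) F h (grid_fun a h (\<lambda>x. U 0 (x, t))) i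
        + U 1 (a + of_int i * h, t)) \<le> C * h ^ (2 * weno_radius R - 1)" ..
  qed
  from local_truncation_error[OF _ \<tau> this]
  show "uniformly_bigo I
      (\<lambda>h a i t. u (a + of_int i * h) (t + \<tau> * h)
        - (\<Sum>l = 0..R. ((\<tau> * h) ^ l / fact l) *\<^sub>R
            approx_deriv R f F h (\<tau> * h) (grid_fun a h (\<lambda>x. u x t)) l i))
      (R + 1)"
    by (simp add: U)
qed

end
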